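(* Let $k$ be an algebraically closed field of characteristic zero, $\mathfrak{g}$ a finite-dimensional simple Lie algebra over $k$ with a fixed Cartan subalgebra $\mathfrak{h}$ and root system $\Phi$, $S$ a commutative, associative, unital $k$-algebra of finite type, and $\mathcal{L}=\mathfrak{g}\otimes_k S$. Let $\lambda$ be a weight of a simple weight $\mathcal{L}$-module $V$. Then $I=J(\lambda,\Phi)$, where $I=I(V)$. In particular, the ring $S/I$ is a finite-dimensional $k$-algebra.
   Context: The Lie bracket on $\mathcal{L}=\mathfrak{g}\otimes S$ is $[x\otimes r,y\otimes s]=[x,y]\otimes rs$. An $\mathcal{L}$-module $V$ is a weight module if $V=\bigoplus_{\lambda\in\mathfrak{h}^*}V_\lambda$ with each weight space $V_\lambda=\{v\in V\mid (h\otimes 1)v=\lambda(h)v\text{ for all }h\in\mathfrak{h}\}$ finite dimensional; $\lambda$ is a weight of $V$ if $V_\lambda\neq0$. Every ideal of $\mathcal{L}$ is of the form $\mathfrak{g}\otimes P$ for an ideal $P$ of $S$; if $\phi:\mathcal{L}\to\operatorname{End}V$ is the module action, $I(V)$ is the ideal of $S$ with $\ker\phi=\mathfrak{g}\otimes I(V)$. Write $\mathfrak{g}=\bigoplus_{\alpha\in\Phi\cup\{0\}}\mathfrak{g}_\alpha$ with $\mathfrak{g}_0=\mathfrak{h}$. For $\alpha\in\Phi\cup\{0\}$, $v\in V$, $\lambda\in\mathfrak{h}^*$, set $J_\alpha(v)=\{s\in S\mid (x\otimes s)v=0\text{ for all }x\in\mathfrak{g}_\alpha\}$, $J(v)=\bigcap_{\beta\in\Phi\cup\{0\}}J_\beta(v)$,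 $J(\lambda)=\bigcap_{w\in V_\lambda}J(w)$, $J(\lambda,\Phi)=\bigcap_{\mu\in\lambda+(\Phi\cup\{0\})}J(\mu)$. *)

theory Defs
  imports "HOL-Computational_Algebra.Polynomial" "HOL-Library.Function_Algebras"
begin

text \<open>
  Vector spaces are types of class \<^class>\<open>ab_group_add\<close> with a scalar multiplication satisfying
  the locale \<open>vector_space\<close>, as in \<^theory>\<open>HOL.Vector_Spaces\<close>.  Throughout, \<open>sg\<close>, \<open>ss\<close>, \<open>sv\<close> are
  the scalar multiplications of the Lie algebra, of the commutative algebra \<open>S\<close> and of the
  module \<open>V\<close>, and \<open>br\<close> is the bracket of the Lie algebra.
\<close>

definition fin_dim_on :: "('k::field \<Rightarrow> 'a::ab_group_add \<Rightarrow> 'a) \<Rightarrow> 'a set \<Rightarrow> bool" where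
  "fin_dim_on sc W \<longleftrightarrow> (\<exists>B. finite B \<and> B \<subseteq> W \<and> module.span sc B = W)"

text \<open>The family \<open>(W i)\<close>, \<open>i \<in> I\<close>, is a decomposition of the whole space as an internal direct sum.\<close>

definition direct_sum_decomposition ::
    "('k::field \<Rightarrow> 'a::ab_group_add \<Rightarrow> 'a) \<Rightarrow> 'i set \<Rightarrow> ('i \<Rightarrow> 'a set) \<Rightarrow> bool" where
  "direct_sum_decomposition sc I W \<longleftrightarrow>
     (\<forall>i\<in>I. module.subspace sc (W i)) \<and>
     (\<forall>v. \<exists>!f. (\<forall>i\<in>I. f i \<in> W i) \<and> (\<forall>i. i \<notin> I \<longrightarrow> f i = 0) \<and>
               finite {i. f i \<noteq> 0} \<and> v = (\<Sum>i | f i \<noteq> 0. f i))"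


section \<open>Lie algebras and Cartan subalgebras\<close>

locale lie_algebra = vector_space sg
  for sg :: "'k::field \<Rightarrow> 'g::ab_group_add \<Rightarrow> 'g" +
  fixes br :: "'g \<Rightarrow> 'g \<Rightarrow> 'g"
  assumes bracket_linear_left: "Vector_Spaces.linear sg sg (\<lambda>x. br x y)"
    and bracket_linear_right: "Vector_Spaces.linear sg sg (br x)"
    and bracket_self: "br x x = 0"
    and jacobi: "br x (br y z) + br y (br z x) + br z (br x y) = 0"

definition lie_ideal :: "('k::field \<Rightarrow> 'g::ab_group_add \<Rightarrow> 'g) \<Rightarrow> ('g \<Rightarrow> 'g \<Rightarrow> 'g) \<Rightarrow> 'g set \<Rightarrow> bool" where
  "lie_ideal sg br A \<longleftrightarrow> module.subspace sg A \<and> (\<forall>x. \<forall>a\<in>A. br x a \<in> A)"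

locale simple_lie_algebra = lie_algebra sg br
  for sg :: "'k::field \<Rightarrow> 'g::ab_group_add \<Rightarrow> 'g"
    and br :: "'g \<Rightarrow> 'g \<Rightarrow> 'g" +
  assumes not_abelian: "\<exists>x y. br x y \<noteq> 0"
    and ideal_trivial: "lie_ideal sg br A \<Longrightarrow> A = {0} \<or> A = UNIV"

primrec lower_central ::
    "('k::field \<Rightarrow> 'g::ab_group_add \<Rightarrow> 'g) \<Rightarrow> ('g \<Rightarrow> 'g \<Rightarrow> 'g) \<Rightarrow> 'g set \<Rightarrow> nat \<Rightarrow> 'g set" where
  "lower_central sg br A 0 = A"
| "lower_central sg br A (Suc n) =
     module.span sg {br x y | x y. x \<in> A \<and> y \<in> lower_central sg br A n}"

text \<open>A Cartan subalgebra is a nilpotent subalgebra that equals its own normalizer.\<close>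

definition cartan_subalgebra ::
    "('k::field \<Rightarrow> 'g::ab_group_add \<Rightarrow> 'g) \<Rightarrow> ('g \<Rightarrow> 'g \<Rightarrow> 'g) \<Rightarrow> 'g set \<Rightarrow> bool" where
  "cartan_subalgebra sg br h \<longleftrightarrow>
     module.subspace sg h \<and> (\<forall>x\<in>h. \<forall>y\<in>h. br x y \<in> h) \<and>
     (\<exists>n. lower_central sg br h n = {0}) \<and>
     {x. \<forall>y\<in>h. br x y \<in> h} = h"

text \<open>
  The dual space of the subspace \<open>h\<close>.  A functional on \<open>h\<close> is encoded as a function on the
  ambient space that is zero outside \<open>h\<close>, so that each functional has exactly one
  representative and functionals add pointwise.
\<close>

definition dual_on :: "('k::field \<Rightarrow> 'g::ab_group_add \<Rightarrow> 'g) \<Rightarrow> 'g set \<Rightarrow> ('g \<Rightarrow> 'k) set" where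
  "dual_on sg h = {\<mu>. (\<forall>x\<in>h. \<forall>y\<in>h. \<mu> (x + y) = \<mu> x + \<mu> y) \<and>
                      (\<forall>c. \<forall>x\<in>h. \<mu> (sg c x) = c * \<mu> x) \<and>
                      (\<forall>x. x \<notin> h \<longrightarrow> \<mu> x = 0)}"

definition root_space ::
    "('k::field \<Rightarrow> 'g::ab_group_add \<Rightarrow> 'g) \<Rightarrow> ('g \<Rightarrow> 'g \<Rightarrow> 'g) \<Rightarrow> 'g set \<Rightarrow> ('g \<Rightarrow> 'k) \<Rightarrow> 'g set" where
  "root_space sg br h \<alpha> = {x. \<forall>y\<in>h. br y x = sg (\<alpha> y) x}"

definition roots ::
    "('k::field \<Rightarrow> 'g::ab_group_add \<Rightarrow> 'g) \<Rightarrow> ('g \<Rightarrow> 'g \<Rightarrow> 'g) \<Rightarrow> 'g set \<Rightarrow> ('g \<Rightarrow> 'k) set" where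
  "roots sg br h = {\<alpha> \<in> dual_on sg h. \<alpha> \<noteq> 0 \<and> root_space sg br h \<alpha> \<noteq> {0}}"

definition graded_piece ::
    "('k::field \<Rightarrow> 'g::ab_group_add \<Rightarrow> 'g) \<Rightarrow> ('g \<Rightarrow> 'g \<Rightarrow> 'g) \<Rightarrow> 'g set \<Rightarrow> ('g \<Rightarrow> 'k) \<Rightarrow> 'g set" where
  "graded_piece sg br h \<alpha> = (if \<alpha> = 0 then h else root_space sg br h \<alpha>)"


section \<open>Commutative algebras\<close>

text \<open>
  The sort \<open>{comm_ring, comm_monoid_mult}\<close> describes commutative, associative, unital rings;
  in contrast to \<^class>\<open>comm_ring_1\<close> it does not exclude the zero ring.
\<close>

locale comm_algebra = vector_space ss
  for ss :: "'k::field \<Rightarrow> 's::{comm_ring,comm_monoid_mult} \<Rightarrow> 's" +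
  assumes scale_mult: "ss c (r * s) = ss c r * s"

definition subalgebra_of :: "('k::field \<Rightarrow> 's::{comm_ring,comm_monoid_mult} \<Rightarrow> 's) \<Rightarrow> 's set \<Rightarrow> bool" where
  "subalgebra_of ss A \<longleftrightarrow> module.subspace ss A \<and> 1 \<in> A \<and> (\<forall>a\<in>A. \<forall>b\<in>A. a * b \<in> A)"

definition finite_type :: "('k::field \<Rightarrow> 's::{comm_ring,comm_monoid_mult} \<Rightarrow> 's) \<Rightarrow> bool" where
  "finite_type ss \<longleftrightarrow> (\<exists>X. finite X \<and> (\<forall>A. subalgebra_of ss A \<and> X \<subseteq> A \<longrightarrow> A = UNIV))"

definition ring_ideal :: "'s::{comm_ring,comm_monoid_mult} set \<Rightarrow> bool" where
  "ring_ideal P \<longleftrightarrow> 0 \<in> P \<and> (\<forall>a\<in>P. \<forall>b\<in>P. a + b \<in> P) \<and> (\<forall>r. \<forall>a\<in>P. r * a \<in> P)"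

definition residue_class :: "'s::{comm_ring,comm_monoid_mult} set \<Rightarrow> 's \<Rightarrow> 's set" where
  "residue_class P s = {t. t - s \<in> P}"

text \<open>
  The quotient algebra \<open>S/P\<close> has the residue classes as its elements, with operations induced
  from \<open>S\<close>; the image of the span of \<open>B\<close> in it is the span of the classes of the elements of
  \<open>B\<close>.
\<close>

definition fin_dim_quotient_algebra ::
    "('k::field \<Rightarrow> 's::{comm_ring,comm_monoid_mult} \<Rightarrow> 's) \<Rightarrow> 's set \<Rightarrow> bool" where
  "fin_dim_quotient_algebra ss P \<longleftrightarrow>
     ring_ideal P \<and>
     (\<exists>B. finite B \<and> range (residue_class P) = residue_class P ` module.span ss B)"


section \<open>The tensor product and the Lie algebra \<open>\<gg> \<otimes> S\<close>\<close>

definition bilinear_map ::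
    "('k::field \<Rightarrow> 'a::ab_group_add \<Rightarrow> 'a) \<Rightarrow> ('k \<Rightarrow> 'b::ab_group_add \<Rightarrow> 'b) \<Rightarrow>
     ('k \<Rightarrow> 'c::ab_group_add \<Rightarrow> 'c) \<Rightarrow> ('a \<Rightarrow> 'b \<Rightarrow> 'c) \<Rightarrow> bool" where
  "bilinear_map s1 s2 s3 B \<longleftrightarrow>
     (\<forall>y. Vector_Spaces.linear s1 s3 (\<lambda>x. B x y)) \<and> (\<forall>x. Vector_Spaces.linear s2 s3 (B x))"

text \<open>
  The tensor product of two vector spaces over a field is realized inside the dual of the space
  of bilinear forms: \<open>x \<otimes> y\<close> is evaluation of bilinear forms at \<open>(x, y)\<close>, and the tensor product
  is the span of these elements.  Functions that are not bilinear are sent to zero.  The universal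
  property is shown in lemmas \<open>tensor_universal_exists\<close> and \<open>tensor_universal_unique\<close> below.
\<close>

type_synonym ('k, 'a, 'b) tensor = "('a \<Rightarrow> 'b \<Rightarrow> 'k) \<Rightarrow> 'k"

definition tensor :: "('k::field \<Rightarrow> 'a::ab_group_add \<Rightarrow> 'a) \<Rightarrow> ('k \<Rightarrow> 'b::ab_group_add \<Rightarrow> 'b) \<Rightarrow>
     'a \<Rightarrow> 'b \<Rightarrow> ('k, 'a, 'b) tensor" where
  "tensor s1 s2 x y = (\<lambda>B. if bilinear_map s1 s2 (*) B then B x y else 0)"

definition tensor_scale :: "'k::field \<Rightarrow> ('k, 'a, 'b) tensor \<Rightarrow> ('k, 'a, 'b) tensor" where
  "tensor_scale c F = (\<lambda>B. c * F B)"

text \<open>The subspace \<open>X \<otimes> Y\<close>, that is, the span of all \<open>x \<otimes> y\<close> with \<open>x \<in> X\<close> and \<open>y \<in> Y\<close>.\<close>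

definition tensor_sub :: "('k::field \<Rightarrow> 'a::ab_group_add \<Rightarrow> 'a) \<Rightarrow> ('k \<Rightarrow> 'b::ab_group_add \<Rightarrow> 'b) \<Rightarrow>
     'a set \<Rightarrow> 'b set \<Rightarrow> ('k, 'a, 'b) tensor set" where
  "tensor_sub s1 s2 X Y = module.span tensor_scale {tensor s1 s2 x y | x y. x \<in> X \<and> y \<in> Y}"

abbreviation tensor_space :: "('k::field \<Rightarrow> 'a::ab_group_add \<Rightarrow> 'a) \<Rightarrow> ('k \<Rightarrow> 'b::ab_group_add \<Rightarrow> 'b) \<Rightarrow>
     ('k, 'a, 'b) tensor set" where
  "tensor_space s1 s2 \<equiv> tensor_sub s1 s2 UNIV UNIV"

lemma vector_space_tensor_scale:
  "vector_space (tensor_scale :: 'k::field \<Rightarrow> ('k, 'a, 'b) tensor \<Rightarrow> ('k, 'a, 'b) tensor)"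
  by unfold_locales (auto simp: tensor_scale_def fun_eq_iff algebra_simps)

lemma vector_space_mult: "vector_space ((*) :: 'k::field \<Rightarrow> 'k \<Rightarrow> 'k)"
  by unfold_locales (auto simp: algebra_simps)

lemma linear_iff_on:
  assumes "vector_space s1" "vector_space s2"
  shows "Vector_Spaces.linear s1 s2 f \<longleftrightarrow>
    (\<forall>x y. f (x + y) = f x + f y) \<and> (\<forall>c x. f (s1 c x) = s2 c (f x))"
  using assms
  by (auto simp: Vector_Spaces.linear_def module_hom_def module_hom_axioms_def
module_iff_vector_space)

lemma bilinear_map_iff:
  assumes "vector_space s1" "vector_space s2" "vector_space s3"
  shows "bilinear_map s1 s2 s3 B \<longleftrightarrow>
    (\<forall>x x' y. B (x + x') y = B x y + B x' y) \<and> (\<forall>c x y. B (s1 c x) y = s3 c (B x y)) \<and>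
    (\<forall>x y y'. B x (y + y') = B x y + B x y') \<and> (\<forall>c x y. B x (s2 c y) = s3 c (B x y))"
  unfolding bilinear_map_def linear_iff_on[OF assms(1,3)] linear_iff_on[OF assms(2,3)] by blast

lemma tensor_bilinear:
  assumes "vector_space s1" "vector_space s2"
  shows "bilinear_map s1 s2 tensor_scale (tensor s1 s2)"
  by (simp add: bilinear_map_iff[OF assms vector_space_tensor_scale] tensor_def tensor_scale_def
      fun_eq_iff bilinear_map_iff[OF assms vector_space_mult])

lemma tensor_universal_exists:
  assumes v1: "vector_space s1" and v2: "vector_space s2" and B: "bilinear_map s1 s2 s3 B"
  shows "\<exists>f. Vector_Spaces.linear tensor_scale s3 f \<and> (\<forall>x y. f (tensor s1 s2 x y) = B x y)"
proof -
  have v3: "vector_space s3"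
    using B by (auto simp: bilinear_map_def Vector_Spaces.linear_def)
  interpret v3: vector_space s3 by fact
  interpret vt: vector_space "tensor_scale :: 'a \<Rightarrow> ('a, 'b, 'c) tensor \<Rightarrow> ('a, 'b, 'c) tensor"
    by (rule vector_space_tensor_scale)
  interpret p: vector_space_pair "tensor_scale :: 'a \<Rightarrow> ('a, 'b, 'c) tensor \<Rightarrow> ('a, 'b, 'c) tensor" s3 ..
  interpret q: vector_space_pair s3 "(*) :: 'a \<Rightarrow> 'a \<Rightarrow> 'a"
    using v3 vector_space_mult by (simp add: vector_space_pair_def)
  let ?T = "{tensor s1 s2 x y | x y. True}"
  obtain C where C: "C \<subseteq> ?T" "vt.independent C" "?T \<subseteq> vt.span C"
    using vt.maximal_independent_subset by blast
  from C(1) have "\<forall>t\<in>C. \<exists>xy. t = tensor s1 s2 (fst xy) (snd xy)" by fastforce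
  then obtain k where k: "\<And>t. t \<in> C \<Longrightarrow> t = tensor s1 s2 (fst (k t)) (snd (k t))" by metis
  obtain f where f: "Vector_Spaces.linear tensor_scale s3 f"
      "\<forall>t\<in>C. f t = B (fst (k t)) (snd (k t))"
    using p.linear_independent_extend[OF C(2), of "\<lambda>t. B (fst (k t)) (snd (k t))"] by blast
  interpret f: Vector_Spaces.linear tensor_scale s3 f by (rule f(1))
  have zero: "w = 0" if "\<And>l. Vector_Spaces.linear s3 (*) l \<Longrightarrow> l w = (0::'a)" for w
  proof (rule ccontr)
    assume "w \<noteq> 0"
    then have "v3.independent {w}" by simp
    from q.linear_independent_extend[OF this, of "\<lambda>_. 1"] that show False by force
  qed
  have form: "bilinear_map s1 s2 (*) (\<lambda>x y. l (B x y))" if l: "Vector_Spaces.linear s3 (*) l" for l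
  proof -
    interpret l: Vector_Spaces.linear s3 "(*)" l by fact
    show ?thesis using B
      by (simp add: bilinear_map_iff[OF v1 v2 v3] bilinear_map_iff[OF v1 v2 vector_space_mult]
          l.add l.scale)
  qed
  have eval: "l (f t) = t (\<lambda>x y. l (B x y))"
    if "t \<in> vt.span C" and l: "Vector_Spaces.linear s3 (*) l" for t l
  proof -
    interpret l: Vector_Spaces.linear s3 "(*)" l by (rule l)
    show ?thesis using that(1)
    proof (induction rule: vt.span_induct_alt)
      case base
      have "l (f 0) = 0" unfolding f.zero by (rule l.zero)
      also have "\<dots> = (0 :: ('a, 'b, 'c) tensor) (\<lambda>x y. l (B x y))" by simp
      finally show ?case .
    next
      case (step c x y)
      have x: "x (\<lambda>x y. l (B x y)) = l (B (fst (k x)) (snd (k x)))"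
        using form[OF l] by (subst k[OF step(1)]) (simp add: tensor_def)
      have eq: "l (f (tensor_scale c x + y)) = c * l (f x) + l (f y)"
        unfolding f.add f.scale l.add l.scale by (rule refl)
      have "f x = B (fst (k x)) (snd (k x))" using f(2) step(1) by blast
      then have fx: "l (f x) = x (\<lambda>x y. l (B x y))" by (rule ssubst) (rule x[symmetric])
      have "l (f (tensor_scale c x + y)) =
          c * x (\<lambda>x y. l (B x y)) + y (\<lambda>x y. l (B x y))"
        unfolding eq by (rule arg_cong2[where f = "\<lambda>a b. c * a + b", OF fx step(2)])
      also have "\<dots> = (tensor_scale c x + y) (\<lambda>x y. l (B x y))"
        by (simp add: tensor_scale_def)
      finally show ?case .
    qed
  qed
  have "f (tensor s1 s2 x y) = B x y" for x y
  proof -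
    have "f (tensor s1 s2 x y) - B x y = 0"
    proof (rule zero)
      fix l assume l: "Vector_Spaces.linear s3 ((*)::'a \<Rightarrow> _) l"
      then interpret l: Vector_Spaces.linear s3 "(*)" l .
      have "tensor s1 s2 x y \<in> vt.span C" using C(3) by blast
      from eval[OF this l] show "l (f (tensor s1 s2 x y) - B x y) = 0"
        using form[OF l] by (simp add: l.diff tensor_def)
    qed
    then show ?thesis by simp
  qed
  with f(1) show "\<exists>f. Vector_Spaces.linear tensor_scale s3 f \<and> (\<forall>x y. f (tensor s1 s2 x y) = B x y)"
    by blast
qed

lemma tensor_universal_unique:
  fixes B :: "'a::ab_group_add \<Rightarrow> 'b::ab_group_add \<Rightarrow> 'c::ab_group_add"
    and s3 :: "'k::field \<Rightarrow> 'c \<Rightarrow> 'c"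
  assumes f: "Vector_Spaces.linear tensor_scale s3 f" "\<And>x y. f (tensor s1 s2 x y) = B x y"
    and g: "Vector_Spaces.linear tensor_scale s3 g" "\<And>x y. g (tensor s1 s2 x y) = B x y"
    and t: "t \<in> tensor_space s1 s2"
  shows "f t = g t"
proof -
  interpret p: vector_space_pair "tensor_scale :: 'k \<Rightarrow> ('k, 'a, 'b) tensor \<Rightarrow> _" s3
    using f(1) by (simp add: Vector_Spaces.linear_def vector_space_pair_def)
  show ?thesis
    by (rule p.linear_eq_on[OF f(1) g(1) t[unfolded tensor_sub_def]]) (use f(2) g(2) in force)
qed

text \<open>
  The bracket of \<open>\<gg> \<otimes> S\<close>.  By lemmas \<open>tensor_bracket_tensor\<close> and \<open>tensor_bracket_bilinear\<close>
  it is the bilinear operation on \<open>\<gg> \<otimes> S\<close> with \<open>[x \<otimes> r, y \<otimes> s] = [x, y] \<otimes> r s\<close>.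
\<close>

definition tensor_bracket ::
    "('k::field \<Rightarrow> 'g::ab_group_add \<Rightarrow> 'g) \<Rightarrow> ('g \<Rightarrow> 'g \<Rightarrow> 'g) \<Rightarrow>
     ('k \<Rightarrow> 's::{comm_ring,comm_monoid_mult} \<Rightarrow> 's) \<Rightarrow>
     ('k, 'g, 's) tensor \<Rightarrow> ('k, 'g, 's) tensor \<Rightarrow> ('k, 'g, 's) tensor" where
  "tensor_bracket sg br ss F G =
     (\<lambda>B. if bilinear_map sg ss (*) B then F (\<lambda>x r. G (\<lambda>y s. B (br x y) (r * s))) else 0)"

lemma tensor_space_linear:
  assumes v1: "vector_space s1" and v2: "vector_space s2" and t: "t \<in> tensor_space s1 s2"
    and B: "bilinear_map s1 s2 (*) B" and C: "bilinear_map s1 s2 (*) C"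
  shows "t (\<lambda>x y. B x y + C x y) = t B + t C" and "t (\<lambda>x y. c * B x y) = c * t B"
proof -
  interpret vt: vector_space "tensor_scale :: 'a \<Rightarrow> ('a, 'b, 'c) tensor \<Rightarrow> ('a, 'b, 'c) tensor"
    by (rule vector_space_tensor_scale)
  have BC: "bilinear_map s1 s2 (*) (\<lambda>x y. B x y + C x y)" "bilinear_map s1 s2 (*) (\<lambda>x y. c * B x y)"
    using B C by (simp_all add: bilinear_map_iff[OF v1 v2 vector_space_mult] algebra_simps)
  have "t (\<lambda>x y. B x y + C x y) = t B + t C \<and> t (\<lambda>x y. c * B x y) = c * t B"
    using t unfolding tensor_sub_def
  proof (induction rule: vt.span_induct_alt)
    case base
    then show ?case by simp
  next
    case (step a x y)
    then show ?case using BC B C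
      by (auto simp: tensor_scale_def tensor_def algebra_simps)
  qed
  then show "t (\<lambda>x y. B x y + C x y) = t B + t C" and "t (\<lambda>x y. c * B x y) = c * t B" by auto
qed

context
  fixes sg :: "'k::field \<Rightarrow> 'g::ab_group_add \<Rightarrow> 'g" and br
    and ss :: "'k \<Rightarrow> 's::{comm_ring,comm_monoid_mult} \<Rightarrow> 's"
  assumes g: "lie_algebra sg br" and S: "comm_algebra ss"
begin

interpretation lie_algebra sg br by (rule g)
interpretation S: comm_algebra ss by (rule S)
interpretation vt: vector_space "tensor_scale :: 'k \<Rightarrow> ('k, 'g, 's) tensor \<Rightarrow> ('k, 'g, 's) tensor"
  by (rule vector_space_tensor_scale)

private lemmas vs = vector_space_axioms S.vector_space_axioms
private lemmas bil_iff = bilinear_map_iff[OF vs vector_space_mult]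

private lemma br_simps:
  "br (x + y) z = br x z + br y z" "br x (y + z) = br x y + br x z"
  "br (sg c x) y = sg c (br x y)" "br x (sg c y) = sg c (br x y)"
  "br x x = 0"
  using bracket_linear_left bracket_linear_right bracket_self
  by (auto simp: linear_iff_on[OF vector_space_axioms vector_space_axioms])

private lemma scale_simps: "ss c r * s = ss c (r * s)" "r * ss c s = ss c (r * s)"
  by (metis S.scale_mult mult.commute)+

private lemma bil_shift: "bilinear_map sg ss (*) B \<Longrightarrow> bilinear_map sg ss (*) (\<lambda>y s. B (br x y) (r * s))"
  by (simp add: bil_iff br_simps scale_simps distrib_left)

lemma tensor_bracket_tensor:
  "tensor_bracket sg br ss (tensor sg ss x r) (tensor sg ss y s) = tensor sg ss (br x y) (r * s)"
proof
  fix B :: "'g \<Rightarrow> 's \<Rightarrow> 'k"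
  show "tensor_bracket sg br ss (tensor sg ss x r) (tensor sg ss y s) B = tensor sg ss (br x y) (r * s) B"
  proof (cases "bilinear_map sg ss (*) B")
    case True
    note sh = bil_shift[OF True]
    have "bilinear_map sg ss (*) (\<lambda>x r. tensor sg ss y s (\<lambda>y s. B (br x y) (r * s)))"
      using True sh by (simp add: tensor_def) (simp add: bil_iff br_simps scale_simps distrib_right)
    with True sh show ?thesis by (simp add: tensor_bracket_def tensor_def)
  qed (simp_all add: tensor_bracket_def tensor_def)
qed

private lemma bil_inner:
  assumes "G \<in> tensor_space sg ss" and B: "bilinear_map sg ss (*) B"
  shows "bilinear_map sg ss (*) (\<lambda>x r. G (\<lambda>y s. B (br x y) (r * s)))"
proof -
  note lin = tensor_space_linear[OF vs assms(1) bil_shift[OF B] bil_shift[OF B]]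
  from B have "G (\<lambda>y s. B (br (x + x') y) (r * s)) = G (\<lambda>y s. B (br x y) (r * s)) + G (\<lambda>y s. B (br x' y) (r * s))"
    "G (\<lambda>y s. B (br x y) ((r + r') * s)) = G (\<lambda>y s. B (br x y) (r * s)) + G (\<lambda>y s. B (br x y) (r' * s))"
    "G (\<lambda>y s. B (br (sg c x) y) (r * s)) = c * G (\<lambda>y s. B (br x y) (r * s))"
    "G (\<lambda>y s. B (br x y) (ss c r * s)) = c * G (\<lambda>y s. B (br x y) (r * s))" for x x' r r' c
    unfolding lin[symmetric] by (simp_all add: bil_iff br_simps scale_simps distrib_right)
  then show ?thesis by (simp add: bil_iff)
qed

lemma tensor_bracket_bilinear:
  "tensor_bracket sg br ss (F + F') G = tensor_bracket sg br ss F G + tensor_bracket sg br ss F' G"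
  "tensor_bracket sg br ss (tensor_scale c F) G = tensor_scale c (tensor_bracket sg br ss F G)"
  "\<lbrakk>F \<in> tensor_space sg ss; G \<in> tensor_space sg ss; G' \<in> tensor_space sg ss\<rbrakk> \<Longrightarrow>
     tensor_bracket sg br ss F (G + G') = tensor_bracket sg br ss F G + tensor_bracket sg br ss F G'"
  "\<lbrakk>F \<in> tensor_space sg ss; G \<in> tensor_space sg ss\<rbrakk> \<Longrightarrow>
     tensor_bracket sg br ss F (tensor_scale c G) = tensor_scale c (tensor_bracket sg br ss F G)"
proof -
  show "tensor_bracket sg br ss F (G + G') = tensor_bracket sg br ss F G + tensor_bracket sg br ss F G'"
    if "F \<in> tensor_space sg ss" "G \<in> tensor_space sg ss" "G' \<in> tensor_space sg ss"
  proof
    fix B show "tensor_bracket sg br ss F (G + G') B = (tensor_bracket sg br ss F G + tensor_bracket sg br ss F G') B"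
      using tensor_space_linear(1)[OF vs that(1) bil_inner[OF that(2)] bil_inner[OF that(3)], of B B]
      by (simp add: tensor_bracket_def)
  qed
  show "tensor_bracket sg br ss F (tensor_scale c G) = tensor_scale c (tensor_bracket sg br ss F G)"
    if "F \<in> tensor_space sg ss" "G \<in> tensor_space sg ss"
  proof
    fix B show "tensor_bracket sg br ss F (tensor_scale c G) B = tensor_scale c (tensor_bracket sg br ss F G) B"
      using tensor_space_linear(2)[OF vs that(1) bil_inner[OF that(2)] bil_inner[OF that(2)], of B B]
      by (simp add: tensor_bracket_def tensor_scale_def)
  qed
qed (auto simp: tensor_bracket_def tensor_scale_def fun_eq_iff)

lemma tensor_bracket_closed:
  assumes "F \<in> tensor_space sg ss" "G \<in> tensor_space sg ss"
  shows "tensor_bracket sg br ss F G \<in> tensor_space sg ss"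
proof -
  let ?T = "{tensor sg ss x r | x r. x \<in> UNIV \<and> r \<in> UNIV}"
  have sub: "vt.subspace (tensor_space sg ss)" by (simp add: tensor_sub_def vt.subspace_span)
  have inT: "t \<in> tensor_space sg ss" if "t \<in> ?T" for t
    using that by (simp add: tensor_sub_def vt.span_base)
  have pure: "tensor_bracket sg br ss t u \<in> tensor_space sg ss" if "t \<in> ?T" "u \<in> ?T" for t u
  proof -
    from that obtain x r y s where "t = tensor sg ss x r" "u = tensor sg ss y s" by blast
    then show ?thesis using inT[of "tensor sg ss (br x y) (r * s)"]
      by (simp only: tensor_bracket_tensor) blast
  qed
  have zero: "tensor_bracket sg br ss t 0 = 0" if "t \<in> tensor_space sg ss" for t
    using tensor_bracket_bilinear(4)[OF that vt.subspace_0[OF sub], of 0] by simp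
  let ?L = "tensor_space sg ss"
  have span_T: "vt.span ?T = ?L" by (simp add: tensor_sub_def)
  have sub_right: "vt.subspace {u \<in> ?L. tensor_bracket sg br ss t u \<in> ?L}" if t: "t \<in> ?L" for t
  proof (rule vt.subspaceI, unfold mem_Collect_eq, goal_cases)
    case 1
    show ?case using vt.subspace_0[OF sub] zero[OF t] by metis
  next
    case (2 u v)
    then show ?case
      using vt.subspace_add[OF sub] tensor_bracket_bilinear(3)[OF t, of u v] by metis
  next
    case (3 c u)
    then show ?case
      using vt.subspace_scale[OF sub] tensor_bracket_bilinear(4)[OF t, of u c] by metis
  qed
  have sub_left: "vt.subspace {t. tensor_bracket sg br ss t G \<in> ?L}"
  proof (rule vt.subspaceI, unfold mem_Collect_eq, goal_cases)
    case 1
    have "tensor_bracket sg br ss 0 G = 0"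
      using tensor_bracket_bilinear(2)[of 0 0 G] vt.scale_zero_left by metis
    then show ?case using vt.subspace_0[OF sub] by metis
  next
    case (2 t u)
    then show ?case
      using vt.subspace_add[OF sub] tensor_bracket_bilinear(1)[of t u G] by metis
  next
    case (3 c t)
    then show ?case
      using vt.subspace_scale[OF sub] tensor_bracket_bilinear(2)[of c t G] by metis
  qed
  have "tensor_bracket sg br ss t G \<in> ?L" if t: "t \<in> ?T" for t
  proof -
    have "?T \<subseteq> {u \<in> ?L. tensor_bracket sg br ss t u \<in> ?L}"
      using inT pure[OF t] by blast
    from vt.span_minimal[OF this sub_right[OF inT[OF t]]] show ?thesis
      using assms(2) unfolding span_T by blast
  qed
  then have "?T \<subseteq> {t. tensor_bracket sg br ss t G \<in> ?L}" by blast
  from vt.span_minimal[OF this sub_left] show ?thesis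
    using assms(1) unfolding span_T by blast
qed

end


section \<open>Modules over \<open>\<gg> \<otimes> S\<close>\<close>

text \<open>
  An action \<open>\<phi>\<close> of \<open>\<gg> \<otimes> S\<close> on \<open>V\<close>.  Only the values of \<open>\<phi>\<close> on elements of \<open>\<gg> \<otimes> S\<close> matter.
\<close>

locale current_module =
  fixes sg :: "'k::field \<Rightarrow> 'g::ab_group_add \<Rightarrow> 'g"
    and br :: "'g \<Rightarrow> 'g \<Rightarrow> 'g"
    and ss :: "'k \<Rightarrow> 's::{comm_ring,comm_monoid_mult} \<Rightarrow> 's"
    and sv :: "'k \<Rightarrow> 'v::ab_group_add \<Rightarrow> 'v"
    and \<phi> :: "('k, 'g, 's) tensor \<Rightarrow> 'v \<Rightarrow> 'v"
  assumes module_vector_space: "vector_space sv"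
    and action_linear:
      "a \<in> tensor_space sg ss \<Longrightarrow> Vector_Spaces.linear sv sv (\<phi> a)"
    and action_add:
      "\<lbrakk>a \<in> tensor_space sg ss; b \<in> tensor_space sg ss\<rbrakk> \<Longrightarrow> \<phi> (a + b) v = \<phi> a v + \<phi> b v"
    and action_scale:
      "a \<in> tensor_space sg ss \<Longrightarrow> \<phi> (tensor_scale c a) v = sv c (\<phi> a v)"
    and action_bracket:
      "\<lbrakk>a \<in> tensor_space sg ss; b \<in> tensor_space sg ss\<rbrakk> \<Longrightarrow>
         \<phi> (tensor_bracket sg br ss a b) v = \<phi> a (\<phi> b v) - \<phi> b (\<phi> a v)"

locale simple_current_module = current_module sg br ss sv \<phi>
  for sg :: "'k::field \<Rightarrow> 'g::ab_group_add \<Rightarrow> 'g"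
    and br :: "'g \<Rightarrow> 'g \<Rightarrow> 'g"
    and ss :: "'k \<Rightarrow> 's::{comm_ring,comm_monoid_mult} \<Rightarrow> 's"
    and sv :: "'k \<Rightarrow> 'v::ab_group_add \<Rightarrow> 'v"
    and \<phi> :: "('k, 'g, 's) tensor \<Rightarrow> 'v \<Rightarrow> 'v" +
  assumes nonzero: "\<exists>v::'v. v \<noteq> 0"
    and submodule_trivial:
      "\<lbrakk>module.subspace sv W; \<And>a w. \<lbrakk>a \<in> tensor_space sg ss; w \<in> W\<rbrakk> \<Longrightarrow> \<phi> a w \<in> W\<rbrakk>
         \<Longrightarrow> W = {0} \<or> W = UNIV"

definition weight_space ::
    "('k::field \<Rightarrow> 'g::ab_group_add \<Rightarrow> 'g) \<Rightarrow> 'g set \<Rightarrow> ('k \<Rightarrow> 's::{comm_ring,comm_monoid_mult} \<Rightarrow> 's) \<Rightarrow>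
     ('k \<Rightarrow> 'v::ab_group_add \<Rightarrow> 'v) \<Rightarrow> (('k, 'g, 's) tensor \<Rightarrow> 'v \<Rightarrow> 'v) \<Rightarrow> ('g \<Rightarrow> 'k) \<Rightarrow> 'v set" where
  "weight_space sg h ss sv \<phi> \<mu> = {v. \<forall>x\<in>h. \<phi> (tensor sg ss x 1) v = sv (\<mu> x) v}"

definition weight_module ::
    "('k::field \<Rightarrow> 'g::ab_group_add \<Rightarrow> 'g) \<Rightarrow> 'g set \<Rightarrow> ('k \<Rightarrow> 's::{comm_ring,comm_monoid_mult} \<Rightarrow> 's) \<Rightarrow>
     ('k \<Rightarrow> 'v::ab_group_add \<Rightarrow> 'v) \<Rightarrow> (('k, 'g, 's) tensor \<Rightarrow> 'v \<Rightarrow> 'v) \<Rightarrow> bool" where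
  "weight_module sg h ss sv \<phi> \<longleftrightarrow>
     direct_sum_decomposition sv (dual_on sg h) (weight_space sg h ss sv \<phi>) \<and>
     (\<forall>\<mu>\<in>dual_on sg h. fin_dim_on sv (weight_space sg h ss sv \<phi> \<mu>))"

definition weights ::
    "('k::field \<Rightarrow> 'g::ab_group_add \<Rightarrow> 'g) \<Rightarrow> 'g set \<Rightarrow> ('k \<Rightarrow> 's::{comm_ring,comm_monoid_mult} \<Rightarrow> 's) \<Rightarrow>
     ('k \<Rightarrow> 'v::ab_group_add \<Rightarrow> 'v) \<Rightarrow> (('k, 'g, 's) tensor \<Rightarrow> 'v \<Rightarrow> 'v) \<Rightarrow> ('g \<Rightarrow> 'k) set" where
  "weights sg h ss sv \<phi> = {\<mu> \<in> dual_on sg h. weight_space sg h ss sv \<phi> \<mu> \<noteq> {0}}"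

text \<open>
  \<open>I(V)\<close> is the ideal \<open>P\<close> of \<open>S\<close> with \<open>ker \<phi> = \<gg> \<otimes> P\<close>.  It exists because every ideal of
  \<open>\<gg> \<otimes> S\<close> has the form \<open>\<gg> \<otimes> P\<close> when \<open>\<gg>\<close> is simple and the field is algebraically closed,
  and \<open>P\<close> is determined by \<open>\<gg> \<otimes> P\<close>.
\<close>

definition kernel_ideal ::
    "('k::field \<Rightarrow> 'g::ab_group_add \<Rightarrow> 'g) \<Rightarrow> ('k \<Rightarrow> 's::{comm_ring,comm_monoid_mult} \<Rightarrow> 's) \<Rightarrow>
     (('k, 'g, 's) tensor \<Rightarrow> 'v::ab_group_add \<Rightarrow> 'v) \<Rightarrow> 's set" where
  "kernel_ideal sg ss \<phi> =
     (THE P. ring_ideal P \<and> {a \<in> tensor_space sg ss. \<forall>v. \<phi> a v = 0} = tensor_sub sg ss UNIV P)"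

text \<open>The sets \<open>J\<^sub>\<alpha>(v)\<close>, \<open>J(v)\<close>, \<open>J(\<lambda>)\<close> and \<open>J(\<lambda>, \<Phi>)\<close>.\<close>

definition J_root ::
    "('k::field \<Rightarrow> 'g::ab_group_add \<Rightarrow> 'g) \<Rightarrow> ('g \<Rightarrow> 'g \<Rightarrow> 'g) \<Rightarrow> 'g set \<Rightarrow>
     ('k \<Rightarrow> 's::{comm_ring,comm_monoid_mult} \<Rightarrow> 's) \<Rightarrow> (('k, 'g, 's) tensor \<Rightarrow> 'v::ab_group_add \<Rightarrow> 'v) \<Rightarrow>
     ('g \<Rightarrow> 'k) \<Rightarrow> 'v \<Rightarrow> 's set" where
  "J_root sg br h ss \<phi> \<alpha> v = {s. \<forall>x\<in>graded_piece sg br h \<alpha>. \<phi> (tensor sg ss x s) v = 0}"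

definition J_vec ::
    "('k::field \<Rightarrow> 'g::ab_group_add \<Rightarrow> 'g) \<Rightarrow> ('g \<Rightarrow> 'g \<Rightarrow> 'g) \<Rightarrow> 'g set \<Rightarrow>
     ('k \<Rightarrow> 's::{comm_ring,comm_monoid_mult} \<Rightarrow> 's) \<Rightarrow> (('k, 'g, 's) tensor \<Rightarrow> 'v::ab_group_add \<Rightarrow> 'v) \<Rightarrow>
     'v \<Rightarrow> 's set" where
  "J_vec sg br h ss \<phi> v = (\<Inter>\<beta>\<in>roots sg br h \<union> {0}. J_root sg br h ss \<phi> \<beta> v)"

definition J_weight ::
    "('k::field \<Rightarrow> 'g::ab_group_add \<Rightarrow> 'g) \<Rightarrow> ('g \<Rightarrow> 'g \<Rightarrow> 'g) \<Rightarrow> 'g set \<Rightarrow>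
     ('k \<Rightarrow> 's::{comm_ring,comm_monoid_mult} \<Rightarrow> 's) \<Rightarrow> ('k \<Rightarrow> 'v::ab_group_add \<Rightarrow> 'v) \<Rightarrow>
     (('k, 'g, 's) tensor \<Rightarrow> 'v \<Rightarrow> 'v) \<Rightarrow> ('g \<Rightarrow> 'k) \<Rightarrow> 's set" where
  "J_weight sg br h ss sv \<phi> \<mu> = (\<Inter>w\<in>weight_space sg h ss sv \<phi> \<mu>. J_vec sg br h ss \<phi> w)"

definition J_weight_roots ::
    "('k::field \<Rightarrow> 'g::ab_group_add \<Rightarrow> 'g) \<Rightarrow> ('g \<Rightarrow> 'g \<Rightarrow> 'g) \<Rightarrow> 'g set \<Rightarrow>
     ('k \<Rightarrow> 's::{comm_ring,comm_monoid_mult} \<Rightarrow> 's) \<Rightarrow> ('k \<Rightarrow> 'v::ab_group_add \<Rightarrow> 'v) \<Rightarrow>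
     (('k, 'g, 's) tensor \<Rightarrow> 'v \<Rightarrow> 'v) \<Rightarrow> ('g \<Rightarrow> 'k) \<Rightarrow> 's set" where
  "J_weight_roots sg br h ss sv \<phi> \<mu> =
     (\<Inter>\<nu>\<in>{\<mu> + \<beta> | \<beta>. \<beta> \<in> roots sg br h \<union> {0}}. J_weight sg br h ss sv \<phi> \<nu>)"

end

theory Submission
  imports Defs
begin

text \<open>
  An ideal of \<open>\<gg> \<otimes> S\<close> is \<open>\<gg> \<otimes> P\<close> by Schur's lemma, so \<open>I(V)\<close> is the set of all \<open>s\<close> for which
  \<open>\<gg> \<otimes> s\<close> acts by zero.

  If \<open>\<gg> \<otimes> 1\<close> acts by zero, then so does \<open>\<gg> \<otimes> S\<close>.  Otherwise \<open>\<gg>\<close> acts faithfully on \<open>V\<close>, where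
  \<open>\<hh>\<close> is diagonal; hence \<open>\<hh>\<close> is abelian and \<open>ad \<hh>\<close> is semisimple, and \<open>\<gg>\<close> has a finite spanning
  set of root vectors and elements of \<open>\<hh>\<close>.

  Let \<open>s \<in> J(\<lambda>, \<Phi>)\<close>.  For \<open>w \<in> V\<^sub>\<lambda>\<close> and a root vector \<open>y\<close>, both \<open>w\<close> and \<open>(y \<otimes> r)w\<close> are killed by
  \<open>\<gg> \<otimes> s\<close>, so \<open>[x, y] \<otimes> rs\<close> kills \<open>w\<close>, and \<open>\<gg> \<otimes> sS\<close> kills \<open>V\<^sub>\<lambda>\<close>.  The vectors killed by the ideal
  \<open>\<gg> \<otimes> sS\<close> form a submodule, which is \<open>V\<close> by simplicity.

  Only finitely many root vectors and basis vectors of weight spaces enter this argument, so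
  \<open>I(V)\<close> is the common kernel of finitely many linear maps from \<open>S\<close> to weight spaces, which are
  finite dimensional.
\<close>

section \<open>Joint eigenvectors\<close>

lemma linear_mapI:
  assumes "vector_space s1" "vector_space s2"
    and "\<And>x y. f (x + y) = f x + f y" "\<And>c x. f (s1 c x) = s2 c (f x)"
  shows "Vector_Spaces.linear s1 s2 f"
  using assms by (simp add: linear_iff_on)

text \<open>A maximal independent set is no larger than a finite spanning set, so it is a finite
  basis. This gives access to the locale \<open>finite_dimensional_vector_space\<close>, which takes
  a basis as parameter.\<close>

lemma fin_dim_on_UNIV_basis:
  assumes "vector_space sc" "fin_dim_on sc UNIV"
  shows "\<exists>B. finite_dimensional_vector_space sc B"
proof -
  interpret vector_space sc by fact
  obtain C where C: "finite C" "span C = UNIV"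
    using assms(2) by (auto simp: fin_dim_on_def)
  obtain B where "independent B" "UNIV \<subseteq> span B"
    by (rule maximal_independent_subset[of UNIV])
  moreover have "finite B"
    using independent_span_bound[OF C(1) \<open>independent B\<close>] C(2) by simp
  ultimately have "finite_dimensional_vector_space sc B"
    by unfold_locales (simp_all add: top.extremum_uniqueI)
  then show ?thesis by blast
qed

section \<open>Polynomials in an endomorphism and eigenvectors\<close>

locale alg_closed_vector_space = finite_dimensional_vector_space scale Basis
  for scale :: "'k::alg_closed_field \<Rightarrow> 'v::ab_group_add \<Rightarrow> 'v" (infixr \<open>*s\<close> 75)
    and Basis :: "'v set"
begin

text \<open>The vector p(T)v, evaluated by Horner's scheme. Fixing \<open>v\<close> avoids sums and
  powers of endomorphisms.\<close>

definition poly_apply :: "('v \<Rightarrow> 'v) \<Rightarrow> 'k poly \<Rightarrow> 'v \<Rightarrow> 'v" where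
  "poly_apply T p v = fold_coeffs (\<lambda>a w. a *s v + T w) p 0"

context
  fixes T :: "'v \<Rightarrow> 'v"
  assumes T: "Vector_Spaces.linear scale scale T"
begin

interpretation T: Vector_Spaces.linear scale scale T by (rule T)

lemma poly_apply_0: "poly_apply T 0 v = 0"
  by (simp add: poly_apply_def)

lemma poly_apply_pCons: "poly_apply T (pCons a p) v = a *s v + T (poly_apply T p v)"
  by (cases "p = 0 \<and> a = 0") (auto simp: poly_apply_def T.zero)

lemma poly_apply_add: "poly_apply T (p + q) v = poly_apply T p v + poly_apply T q v"
  by (induction p q rule: poly_induct2)
    (simp_all add: poly_apply_0 poly_apply_pCons T.add scale_left_distrib)

lemma poly_apply_smult: "poly_apply T (smult c p) v = c *s poly_apply T p v"
  by (induction p) (simp_all add: poly_apply_0 poly_apply_pCons T.scale scale_right_distrib)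

text \<open>Pulling T - c out to the left is what turns a root of an annihilating polynomial into an
  eigenvalue.\<close>

lemma poly_apply_linear_factor:
  "poly_apply T ([:- c, 1:] * q) v = T (poly_apply T q v) - c *s poly_apply T q v"
proof -
  have "[:- c, 1:] * q = smult (- c) q + pCons 0 q" by simp
  then show ?thesis by (simp only: poly_apply_add poly_apply_smult poly_apply_pCons) simp
qed

lemma poly_apply_in_stable:
  assumes "subspace U" "T ` U \<subseteq> U" "v \<in> U"
  shows "poly_apply T p v \<in> U"
  using assms
  by (induction p)
    (auto simp: poly_apply_0 poly_apply_pCons intro!: subspace_0 subspace_add subspace_scale)

text \<open>Otherwise v, Tv, T^2 v, ... are independent: expressing T^n v by lower powers would give
  a monic polynomial of degree n that kills \<open>v\<close>. The dimension bounds the number of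
  such vectors.\<close>

lemma annihilating_poly_exists: "\<exists>p. p \<noteq> 0 \<and> poly_apply T p v = 0"
proof (rule ccontr)
  assume "\<nexists>p. p \<noteq> 0 \<and> poly_apply T p v = 0"
  then have inj: "p = 0" if "poly_apply T p v = 0" for p
    using that by blast
  define g where "g i = poly_apply T (monom 1 i) v" for i
  \<comment> \<open>The disjunct \<open>p = 0\<close> keeps the zero vector in \<open>L 0\<close>,
    since the zero polynomial has degree 0.\<close>
  define L where "L n = (\<lambda>p. poly_apply T p v) ` {p. p = 0 \<or> degree p < n}" for n
  have "subspace (L n)" for n
  proof (rule subspaceI)
    show "0 \<in> L n" by (force simp: L_def poly_apply_0)
  next
    fix x y assume "x \<in> L n" "y \<in> L n"
    then obtain p q where "x = poly_apply T p v" "y = poly_apply T q v"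
      "p = 0 \<or> degree p < n" "q = 0 \<or> degree q < n" by (auto simp: L_def)
    then have "x + y = poly_apply T (p + q) v" "p + q = 0 \<or> degree (p + q) < n"
      by (auto simp: poly_apply_add degree_add_less)
    then show "x + y \<in> L n" by (auto simp: L_def)
  next
    fix c x assume "x \<in> L n"
    then obtain p where "x = poly_apply T p v" "p = 0 \<or> degree p < n" by (auto simp: L_def)
    then have "c *s x = poly_apply T (smult c p) v" "smult c p = 0 \<or> degree (smult c p) < n"
      by (auto simp: poly_apply_smult intro: le_less_trans[OF degree_smult_le])
    then show "c *s x \<in> L n" by (auto simp: L_def)
  qed
  moreover have "g ` {..<n} \<subseteq> L n" for n
    by (auto simp: g_def L_def degree_monom_eq)
  ultimately have span_L: "span (g ` {..<n}) \<subseteq> L n" for n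
    by (intro span_minimal)
  have new: "g n \<notin> span (g ` {..<n})" for n
  proof
    assume "g n \<in> span (g ` {..<n})"
    then obtain p where p: "g n = poly_apply T p v" "p = 0 \<or> degree p < n"
      using span_L by (force simp: L_def)
    have "poly_apply T (monom 1 n + smult (- 1) p) v = 0"
      using p(1) by (simp only: poly_apply_add poly_apply_smult) (simp add: g_def)
    then have "monom 1 n = p" using inj by fastforce
    with p(2) show False by (auto simp: degree_monom_eq)
  qed
  have "independent (g ` {..<n}) \<and> card (g ` {..<n}) = n" for n
  proof (induction n)
    case 0
    then show ?case by (simp add: independent_empty)
  next
    case (Suc n)
    have "g n \<notin> g ` {..<n}" using new[of n] span_superset[of "g ` {..<n}"] by (auto simp only: subset_iff)
    then show ?case
      using Suc new by (simp add: lessThan_Suc independent_insertI)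
  qed
  note this[of "Suc (dim UNIV)"]
  moreover from this have "card (g ` {..<Suc (dim UNIV)}) \<le> dim UNIV"
    by (intro independent_card_le_dim) auto
  ultimately show False by linarith
qed

text \<open>Let p be nonzero of least degree with p(T)v = 0, and write p = (X - c)q. By minimality
  q(T)v is nonzero, and T - c kills it. Stability of \<open>U\<close> keeps it in
  \<open>U\<close>.\<close>

lemma eigenvector_exists:
  assumes U: "subspace U" "T ` U \<subseteq> U" and v: "v \<in> U" "v \<noteq> 0"
  shows "\<exists>c. \<exists>u\<in>U. u \<noteq> 0 \<and> T u = c *s u"
proof -
  define p where "p = arg_min degree (\<lambda>p. p \<noteq> 0 \<and> poly_apply T p v = 0)"
  have p: "p \<noteq> 0" "poly_apply T p v = 0"
    using arg_min_natI[of "\<lambda>p. p \<noteq> 0 \<and> poly_apply T p v = 0" _ degree]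
      annihilating_poly_exists[of v] unfolding p_def by blast+
  have min: "degree p \<le> degree q" if "q \<noteq> 0" "poly_apply T q v = 0" for q
    using arg_min_nat_le[of "\<lambda>p. p \<noteq> 0 \<and> poly_apply T p v = 0" q degree] that
    unfolding p_def by blast
  \<comment> \<open>A nonzero constant kills only the zero vector.\<close>
  have "degree p > 0"
  proof (rule ccontr)
    assume "\<not> degree p > 0"
    then obtain a where "p = [:a:]" by (metis degree_eq_zeroE not_gr_zero)
    with p v show False by (simp add: poly_apply_pCons poly_apply_0 T.zero)
  qed
  then obtain c where "poly p c = 0"
    using alg_closed_imp_poly_has_root by blast
  then obtain q where q: "p = [:- c, 1:] * q" by (auto simp: poly_eq_0_iff_dvd)
  with p have "q \<noteq> 0" by auto
  have "degree q < degree p"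
    unfolding q using \<open>q \<noteq> 0\<close> by (subst degree_mult_eq) auto
  with min[OF \<open>q \<noteq> 0\<close>] have "poly_apply T q v \<noteq> 0" by fastforce
  moreover have "T (poly_apply T q v) = c *s poly_apply T q v"
    using p(2) unfolding q poly_apply_linear_factor by simp
  ultimately show ?thesis using poly_apply_in_stable[OF U v(1)] by blast
qed

end

section \<open>Simultaneous diagonalization of commuting semisimple endomorphisms\<close>

text \<open>By \<open>ss\<close>, the map is injective on the image of \<open>U\<close>, hence
  bijective there by dimension. So \<open>T u = T w\<close> for some \<open>w\<close> in that image,
  and \<open>u - w\<close> lies in the kernel.\<close>

lemma ker_plus_image:
  assumes T: "Vector_Spaces.linear scale scale T" and U: "subspace U" "T ` U \<subseteq> U"
    and ss: "\<And>x. T (T x) = 0 \<Longrightarrow> T x = 0" and u: "u \<in> U"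
  shows "\<exists>w\<in>T ` U. u - w \<in> U \<and> T (u - w) = 0"
proof -
  interpret T: Vector_Spaces.linear scale scale T by (rule T)
  interpret pair: finite_dimensional_vector_space_pair_1 scale Basis scale ..
  have sub: "subspace (T ` U)" using U(1) by (rule T.subspace_image)
  have "inj_on T (T ` U)"
  proof (rule inj_onI)
    fix x y assume "x \<in> T ` U" "y \<in> T ` U" "T x = T y"
    then obtain a b where ab: "x = T a" "y = T b" by auto
    with \<open>T x = T y\<close> have "T (T (a - b)) = 0" by (simp add: T.diff)
    from ss[OF this] show "x = y" using ab by (simp add: T.diff)
  qed
  then have "dim (T ` T ` U) = dim (T ` U)"
    using pair.dim_image_eq[OF T, of "T ` U"] sub by (simp add: span_eq_iff[THEN iffD2])
  moreover have "T ` T ` U \<subseteq> T ` U" using U(2) by blast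
  ultimately have "T ` T ` U = T ` U"
    using subspace_dim_equal[OF T.subspace_image[OF sub] sub] by simp
  then obtain w where w: "w \<in> T ` U" "T u = T w" using u by (metis imageE imageI)
  then have "u - w \<in> U" using u U by (auto intro: subspace_diff)
  with w show ?thesis by (auto simp: T.diff)
qed

text \<open>Semisimplicity says that (T - c)^2 x = 0 forces (T - c)x = 0. If some T is not a scalar
  on \<open>U\<close>, take an eigenvalue c of T on \<open>U\<close>: then \<open>U\<close> is the
  sum of the kernel and the image of T - c. Both are stable because the family commutes, and both
  are proper, so induction on the dimension applies.\<close>

lemma span_joint_eigenvectors:
  fixes \<T> :: "('v \<Rightarrow> 'v) set"
  assumes lin: "\<And>T. T \<in> \<T> \<Longrightarrow> Vector_Spaces.linear scale scale T"
    and commute: "\<And>T T' x. T \<in> \<T> \<Longrightarrow> T' \<in> \<T> \<Longrightarrow> T (T' x) = T' (T x)"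
    and semisimple: "\<And>T c x. T \<in> \<T> \<Longrightarrow> T (T x - c *s x) = c *s (T x - c *s x) \<Longrightarrow> T x = c *s x"
    and U: "subspace U" "\<And>T. T \<in> \<T> \<Longrightarrow> T ` U \<subseteq> U"
  shows "U \<subseteq> span {x \<in> U. \<forall>T\<in>\<T>. \<exists>c. T x = c *s x}"
  using U
proof (induction "dim U" arbitrary: U rule: less_induct)
  case less
  let ?E = "\<lambda>U. {x \<in> U. \<forall>T\<in>\<T>. \<exists>c. T x = c *s x}"
  show ?case
  proof (cases "\<exists>T\<in>\<T>. \<forall>c. \<exists>x\<in>U. T x \<noteq> c *s x")
    case False
    then have "?E U = U" by blast
    then show ?thesis by (simp add: span_superset)
  next
    case True
    then obtain T where T: "T \<in> \<T>" and nonscalar: "\<And>c. \<exists>x\<in>U. T x \<noteq> c *s x" by blast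
    interpret T: Vector_Spaces.linear scale scale T by (rule lin[OF T])
    obtain v where v: "v \<in> U" "v \<noteq> 0"
      using nonscalar[of 0] T.zero by (metis scale_zero_left)
    obtain c u where u: "u \<in> U" "u \<noteq> 0" "T u = c *s u"
      using eigenvector_exists[OF lin[OF T] less.prems(1) less.prems(2)[OF T] v] by blast
    define N where "N x = T x - c *s x" for x
    have N: "Vector_Spaces.linear scale scale N"
      by (rule linear_mapI[OF vector_space_axioms vector_space_axioms])
        (simp_all add: N_def T.add T.scale algebra_simps)
    interpret N: Vector_Spaces.linear scale scale N by (rule N)
    have NU: "N ` U \<subseteq> U"
      using less.prems T by (auto simp: N_def intro!: subspace_diff subspace_scale)
    define Kr where "Kr = {x \<in> U. N x = 0}"
    have Nss: "N x = 0" if "N (N x) = 0" for x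
      using semisimple[OF T, of x c] that by (simp add: N_def)
    have Kr: "subspace Kr"
      using less.prems(1) by (auto simp: Kr_def subspace_def N.zero N.add N.scale)
    have Im: "subspace (N ` U)" using less.prems(1) by (rule N.subspace_image)
    have NT: "N (T' x) = T' (N x)" if "T' \<in> \<T>" for T' x
    proof -
      interpret T': Vector_Spaces.linear scale scale T' by (rule lin[OF that])
      show ?thesis by (simp add: N_def commute[OF T that] T'.diff T'.scale)
    qed
    have T'0: "T' 0 = 0" if "T' \<in> \<T>" for T'
    proof -
      interpret T': Vector_Spaces.linear scale scale T' by (rule lin[OF that])
      show ?thesis by (rule T'.zero)
    qed
    have Kr_stable: "T' ` Kr \<subseteq> Kr" if "T' \<in> \<T>" for T'
      using less.prems(2)[OF that] NT[OF that] T'0[OF that] by (auto simp: Kr_def)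
    have Im_stable: "T' ` N ` U \<subseteq> N ` U" if "T' \<in> \<T>" for T'
      using less.prems(2)[OF that] NT[OF that] by (auto simp: image_iff) (metis image_subset_iff)
    have "Kr \<noteq> U" using nonscalar[of c] by (auto simp: Kr_def N_def)
    then have "dim Kr < dim U"
      using dim_psubset[of Kr U] Kr less.prems(1)
      by (simp add: span_eq_iff[THEN iffD2]) (auto simp: Kr_def)
    from less.hyps[OF this Kr Kr_stable] have 1: "Kr \<subseteq> span (?E Kr)" .
    \<comment> \<open>If the eigenvector \<open>u\<close> were \<open>N w\<close>, then
      \<open>N (N w) = 0\<close>, and semisimplicity would give \<open>u = N w = 0\<close>.\<close>
    have "N ` U \<noteq> U"
    proof
      assume "N ` U = U"
      then obtain w where "w \<in> U" "u = N w" using u(1) by blast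
      with Nss[of w] u show False by (simp add: N_def)
    qed
    then have "dim (N ` U) < dim U"
      using dim_psubset[of "N ` U" U] Im NU less.prems(1)
      by (simp add: span_eq_iff[THEN iffD2] psubset_eq)
    from less.hyps[OF this Im Im_stable] have 2: "N ` U \<subseteq> span (?E (N ` U))" .
    have "span (?E Kr) \<subseteq> span (?E U)" "span (?E (N ` U)) \<subseteq> span (?E U)"
      using NU by (auto intro!: span_mono simp: Kr_def)
    with 1 2 have 3: "Kr \<subseteq> span (?E U)" "N ` U \<subseteq> span (?E U)" by auto
    show ?thesis
    proof
      fix x assume "x \<in> U"
      from ker_plus_image[OF N less.prems(1) NU Nss this]
      obtain w where "w \<in> N ` U" "x - w \<in> Kr" by (auto simp: Kr_def)
      with 3 have "(x - w) + w \<in> span (?E U)" by (intro span_add) auto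
      then show "x \<in> span (?E U)" by simp
    qed
  qed
qed

end


section \<open>Ideals of \<open>\<gg> \<otimes> S\<close>\<close>

context lie_algebra
begin

lemma bracket_simps:
  "br (x + y) z = br x z + br y z" "br x (y + z) = br x y + br x z"
  "br (sg c x) y = sg c (br x y)" "br x (sg c y) = sg c (br x y)"
  using bracket_linear_left bracket_linear_right
  by (auto simp: linear_iff_on[OF vector_space_axioms vector_space_axioms])

lemma bracket_0: "br 0 x = 0" "br x 0 = 0"
  using bracket_simps(3)[of 0 0 x] bracket_simps(4)[of x 0 0] by simp_all

lemma bracket_minus: "br (- x) y = - br x y" "br x (- y) = - br x y"
  using bracket_simps(3)[of "- 1" x y] bracket_simps(4)[of x "- 1" y] by simp_all

lemma bracket_antisym: "br x y = - br y x"
proof -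
  have "br (x + y) (x + y) = br x y + br y x"
    unfolding bracket_simps by (simp add: bracket_self)
  then show ?thesis by (simp add: bracket_self eq_neg_iff_add_eq_0)
qed

end

locale current_algebra = simple_lie_algebra sg br + S: comm_algebra ss
  for sg :: "'k::alg_closed_field \<Rightarrow> 'g::ab_group_add \<Rightarrow> 'g"
    and br :: "'g \<Rightarrow> 'g \<Rightarrow> 'g"
    and ss :: "'k \<Rightarrow> 's::{comm_ring,comm_monoid_mult} \<Rightarrow> 's" +
  assumes fin_dim: "fin_dim_on sg UNIV"
begin

text \<open>The span is an ideal, and it is nonzero because the algebra is not abelian. A linear
  condition on the Lie algebra therefore has to be checked on brackets only.\<close>

lemma span_brackets: "span {br x y | x y. True} = UNIV"
proof -
  have "lie_ideal sg br (span {br x y | x y. True})"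
    by (auto simp: lie_ideal_def intro: span_base)
  moreover obtain x y where "br x y \<noteq> 0" using not_abelian by blast
  then have "span {br x y | x y. True} \<noteq> {0}"
    using span_base[of "br x y" "{br x y | x y. True}"] by blast
  ultimately show ?thesis using ideal_trivial by blast
qed

text \<open>An eigenvalue c of \<open>f\<close> exists over an algebraically closed field. Its
  eigenspace is an ideal, since \<open>f\<close> commutes with the adjoint action, so it is
  everything.\<close>

lemma schur:
  assumes f: "Vector_Spaces.linear sg sg f" and equi: "\<And>x y. f (br x y) = br x (f y)"
  shows "\<exists>c. \<forall>x. f x = sg c x"
proof -
  interpret f: Vector_Spaces.linear sg sg f by (rule f)
  obtain B where "finite_dimensional_vector_space sg B"
    using fin_dim_on_UNIV_basis[OF vector_space_axioms fin_dim] by blast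
  then interpret g: alg_closed_vector_space sg B by (simp add: alg_closed_vector_space_def)
  obtain v :: 'g where "v \<noteq> 0" using not_abelian by metis
  then obtain c u where u: "u \<noteq> 0" "f u = sg c u"
    using g.eigenvector_exists[OF f, of UNIV v] by auto
  have "lie_ideal sg br {x. f x = sg c x}"
    by (auto simp: lie_ideal_def subspace_def f.zero f.add f.scale equi bracket_simps
        scale_right_distrib mult.commute)
  with u have "{x. f x = sg c x} = UNIV" using ideal_trivial by blast
  then show ?thesis by blast
qed

section \<open>Arithmetic of pure tensors\<close>

abbreviation tens (infixl \<open>\<otimes>\<close> 70) where "x \<otimes> s \<equiv> tensor sg ss x s"
abbreviation "current \<equiv> tensor_space sg ss"

sublocale vt: vector_space "tensor_scale :: 'k \<Rightarrow> ('k, 'g, 's) tensor \<Rightarrow> ('k, 'g, 's) tensor"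
  by (rule vector_space_tensor_scale)

lemma tens_simps:
  "(x + x') \<otimes> s = x \<otimes> s + x' \<otimes> s" "x \<otimes> (s + s') = x \<otimes> s + x \<otimes> s'"
  "sg c x \<otimes> s = tensor_scale c (x \<otimes> s)" "x \<otimes> ss c s = tensor_scale c (x \<otimes> s)"
  using tensor_bilinear[OF vector_space_axioms S.vector_space_axioms]
  unfolding bilinear_map_iff[OF vector_space_axioms S.vector_space_axioms vector_space_tensor_scale]
  by simp_all

lemma tens_0: "0 \<otimes> s = 0" "x \<otimes> 0 = 0"
  using tens_simps(3)[of 0 0 s] tens_simps(4)[of x 0 0] by simp_all

lemma tens_diff: "(x - x') \<otimes> s = x \<otimes> s - x' \<otimes> s"
  using tens_simps(1)[of "x - x'" x' s] by (simp add: algebra_simps)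

lemma tens_sum: "x \<otimes> (\<Sum>i\<in>F. s i) = (\<Sum>i\<in>F. x \<otimes> s i)"
  by (induction F rule: infinite_finite_induct; simp only: tens_0 tens_simps sum.infinite
      sum.empty sum.insert not_False_eq_True)

lemma tens_in_current: "x \<otimes> s \<in> current"
  unfolding tensor_sub_def by (rule vt.span_base) blast

lemma subspace_current: "vt.subspace current"
  unfolding tensor_sub_def by (rule vt.subspace_span)

lemma tens_sum_in_current: "(\<Sum>s\<in>F. y s \<otimes> s) \<in> current"
  by (rule vt.subspace_sum[OF subspace_current tens_in_current])

lemmas tens_bracket = tensor_bracket_tensor[OF lie_algebra_axioms S.comm_algebra_axioms]
lemmas tens_bracket_bilinear = tensor_bracket_bilinear[OF lie_algebra_axioms S.comm_algebra_axioms]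

lemma tens_bracket_sum:
  assumes "finite F"
  shows "tensor_bracket sg br ss (z \<otimes> 1) (\<Sum>s\<in>F. y s \<otimes> s) = (\<Sum>s\<in>F. br z (y s) \<otimes> s)"
  using assms
proof (induction F)
  case empty
  have "tensor_bracket sg br ss (z \<otimes> 1) (0 \<otimes> 0) = 0"
    unfolding tens_bracket by (simp only: bracket_0 tens_0)
  then show ?case by (simp only: sum.empty tens_0)
next
  case (insert s F)
  show ?case
    by (simp only: sum.insert[OF insert.hyps]
        tens_bracket_bilinear(3)[OF tens_in_current tens_in_current tens_sum_in_current]
        insert.IH tens_bracket mult_1)
qed

text \<open>Terms with the same second factor are collected into one.\<close>

lemma tens_span_decomposition:
  assumes "t \<in> vt.span {x \<otimes> b | x b. b \<in> D}"
  shows "\<exists>F y. finite F \<and> F \<subseteq> D \<and> t = (\<Sum>b\<in>F. y b \<otimes> b)"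
  using assms
proof (induction rule: vt.span_induct_alt)
  case base
  then show ?case by (intro exI[of _ "{}"]) simp
next
  case (step c t u)
  then obtain F y where F: "finite F" "F \<subseteq> D" "u = (\<Sum>b\<in>F. y b \<otimes> b)" by blast
  from step obtain x b where b: "t = x \<otimes> b" "b \<in> D" by blast
  \<comment> \<open>The two guards treat \<open>b \<in> F\<close> and \<open>b \<notin> F\<close> at
    once; outside \<open>F\<close> the values of \<open>y\<close> are arbitrary and must be
    suppressed.\<close>
  define y' where "y' = (\<lambda>d. (if d = b then sg c x else 0) + (if d \<in> F then y d else 0))"
  have "(\<Sum>d\<in>insert b F. y' d \<otimes> d) =
      (\<Sum>d\<in>insert b F. (if d = b then sg c x else 0) \<otimes> d) +
      (\<Sum>d\<in>insert b F. (if d \<in> F then y d else 0) \<otimes> d)"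
    unfolding y'_def tens_simps(1) by (rule sum.distrib)
  also have "(\<Sum>d\<in>insert b F. (if d = b then sg c x else 0) \<otimes> d) =
      (\<Sum>d\<in>{b}. (if d = b then sg c x else 0) \<otimes> d)"
    using F(1) by (intro sum.mono_neutral_right) (auto simp only: tens_0 insert_iff if_False Diff_iff finite_insert)
  also have "\<dots> = tensor_scale c t" by (simp add: b(1) tens_simps(3))
  also have "(\<Sum>d\<in>insert b F. (if d \<in> F then y d else 0) \<otimes> d) =
      (\<Sum>d\<in>F. (if d \<in> F then y d else 0) \<otimes> d)"
    using F(1) by (intro sum.mono_neutral_right) (auto simp only: tens_0 insert_iff if_False Diff_iff finite_insert)
  also have "\<dots> = u" unfolding F(3) by (rule sum.cong) simp_all
  finally have "tensor_scale c t + u = (\<Sum>d\<in>insert b F. y' d \<otimes> d)" by (rule sym)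
  then show ?case using F b(2) by (intro exI[of _ "insert b F"] exI[of _ y']) blast
qed

section \<open>Ideals of the current algebra and their coefficient ideals\<close>

text \<open>For an ideal \<open>K\<close> this is the only candidate for the \<open>P\<close> with
  \<open>K = tensor_sub sg ss UNIV P\<close>.\<close>

definition coeff_ideal :: "('k, 'g, 's) tensor set \<Rightarrow> 's set" where
  "coeff_ideal K = {s. \<forall>x. x \<otimes> s \<in> K}"

context
  fixes K :: "('k, 'g, 's) tensor set"
  assumes K_subspace: "vt.subspace K" and K_current: "K \<subseteq> current"
    and K_bracket: "\<And>z r t. t \<in> K \<Longrightarrow> tensor_bracket sg br ss (z \<otimes> r) t \<in> K"
begin

lemma subspace_coeff_ideal: "S.subspace (coeff_ideal K)"
  by (rule S.subspaceI) (auto simp: coeff_ideal_def tens_simps tens_0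
      intro: vt.subspace_0[OF K_subspace] vt.subspace_add[OF K_subspace] vt.subspace_scale[OF K_subspace])

text \<open>Bracketing \<open>y \<otimes> a\<close> with \<open>x \<otimes> r\<close> gives
  \<open>br x y \<otimes> (r * a)\<close>, and brackets span the Lie algebra.\<close>

lemma ring_ideal_coeff_ideal: "ring_ideal (coeff_ideal K)"
  unfolding ring_ideal_def
proof (intro conjI ballI allI)
  show "0 \<in> coeff_ideal K" by (rule S.subspace_0[OF subspace_coeff_ideal])
  show "a + b \<in> coeff_ideal K" if "a \<in> coeff_ideal K" "b \<in> coeff_ideal K" for a b
    using that by (rule S.subspace_add[OF subspace_coeff_ideal])
  fix r a assume a: "a \<in> coeff_ideal K"
  have "subspace {x. x \<otimes> (r * a) \<in> K}"
    by (rule subspaceI) (auto simp: tens_simps tens_0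
      intro: vt.subspace_0[OF K_subspace] vt.subspace_add[OF K_subspace] vt.subspace_scale[OF K_subspace])
  moreover have "br x y \<otimes> (r * a) \<in> K" for x y
    using K_bracket[of "y \<otimes> a" x r] a by (simp add: tens_bracket coeff_ideal_def)
  then have "{br x y | x y. True} \<subseteq> {x. x \<otimes> (r * a) \<in> K}" by blast
  ultimately have "span {br x y | x y. True} \<subseteq> {x. x \<otimes> (r * a) \<in> K}" by (rule span_minimal[rotated])
  then show "r * a \<in> coeff_ideal K" unfolding span_brackets by (auto simp: coeff_ideal_def)
qed

text \<open>
  The coefficient tuples \<open>y\<close> with \<open>\<Sum> y\<^sub>s \<otimes> s \<in> K\<close> form a \<open>\<gg>\<close>-submodule \<open>M\<close>.  By induction
  the projection of \<open>M\<close> to the coordinate \<open>s\<^sub>0\<close> is injective, and its image is an ideal of \<open>\<gg>\<close>.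
  If it is onto, Schur's lemma makes every coordinate of \<open>M\<close> a scalar multiple of the one at
  \<open>s\<^sub>0\<close>, which is a nontrivial linear relation modulo the coefficient ideal.
\<close>

lemma coefficients_eq_0:
  assumes "finite F" and "\<And>c. (\<Sum>s\<in>F. ss (c s) s) \<in> coeff_ideal K \<Longrightarrow> \<forall>s\<in>F. c s = 0"
    and "(\<Sum>s\<in>F. y s \<otimes> s) \<in> K" and "s \<in> F"
  shows "y s = 0"
  using assms
proof (induction F arbitrary: y s rule: finite_induct)
  case empty
  then show ?case by simp
next
  case (insert s0 F)
  let ?G = "insert s0 F"
  \<comment> \<open>A relation on \<open>F\<close> becomes one on \<open>?G\<close> by giving
    \<open>s0\<close> the coefficient 0.\<close>
  have "\<forall>s\<in>F. c s = 0" if "(\<Sum>s\<in>F. ss (c s) s) \<in> coeff_ideal K" for c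
  proof -
    have "(\<Sum>s\<in>F. ss ((c(s0 := 0)) s) s) = (\<Sum>s\<in>F. ss (c s) s)"
      using insert.hyps by (intro sum.cong) auto
    then have "(\<Sum>s\<in>?G. ss ((c(s0 := 0)) s) s) \<in> coeff_ideal K"
      using insert.hyps that by simp
    from insert.prems(1)[OF this] have "\<forall>s\<in>F. (c(s0 := 0)) s = 0" by blast
    with insert.hyps(2) show ?thesis by (metis fun_upd_other)
  qed
  note F_eq_0 = insert.IH[OF this]
  define M where "M = {y. (\<Sum>s\<in>?G. y s \<otimes> s) \<in> K}"
  have M_0: "(\<lambda>_. 0) \<in> M"
    by (simp add: M_def tens_0 vt.subspace_0[OF K_subspace])
  have M_add: "(\<lambda>s. y s + y' s) \<in> M" if "y \<in> M" "y' \<in> M" for y y'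
    using vt.subspace_add[OF K_subspace, of "\<Sum>s\<in>?G. y s \<otimes> s" "\<Sum>s\<in>?G. y' s \<otimes> s"] that
    unfolding M_def mem_Collect_eq tens_simps(1) sum.distrib .
  have M_scale: "(\<lambda>s. sg c (y s)) \<in> M" if "y \<in> M" for y c
    using vt.subspace_scale[OF K_subspace, of "\<Sum>s\<in>?G. y s \<otimes> s" c] that
    unfolding M_def mem_Collect_eq tens_simps(3) vt.scale_sum_right .
  have M_diff: "(\<lambda>s. y s - y' s) \<in> M" if "y \<in> M" "y' \<in> M" for y y'
    using vt.subspace_diff[OF K_subspace, of "\<Sum>s\<in>?G. y s \<otimes> s" "\<Sum>s\<in>?G. y' s \<otimes> s"] that
    unfolding M_def mem_Collect_eq tens_diff sum_subtractf .
  have M_bracket: "(\<lambda>s. br z (y s)) \<in> M" if "y \<in> M" for y z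
    using K_bracket[of "\<Sum>s\<in>?G. y s \<otimes> s" z 1] that insert.hyps
    unfolding M_def mem_Collect_eq by (subst (asm) tens_bracket_sum) auto
  have M_eq_0: "y s = 0" if "y \<in> M" "y s0 = 0" "s \<in> ?G" for y s
  proof -
    have "(\<Sum>s\<in>F. y s \<otimes> s) \<in> K"
      using that insert.hyps by (simp add: M_def tens_0)
    then show ?thesis using F_eq_0 that by blast
  qed
  have M_unique: "y s = y' s" if "y \<in> M" "y' \<in> M" "y s0 = y' s0" "s \<in> ?G" for y y' s
    using M_eq_0[OF M_diff[OF that(1,2)] _ that(4)] that(3) by simp
  have "lie_ideal sg br {y s0 | y. y \<in> M}"
    unfolding lie_ideal_def
  proof (intro conjI allI ballI)
    show "subspace {y s0 | y. y \<in> M}"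
    proof (rule subspaceI)
      show "0 \<in> {y s0 | y. y \<in> M}" using M_0 by force
    next
      fix a b assume "a \<in> {y s0 | y. y \<in> M}" "b \<in> {y s0 | y. y \<in> M}"
      then show "a + b \<in> {y s0 | y. y \<in> M}" using M_add by force
    next
      fix c a assume "a \<in> {y s0 | y. y \<in> M}"
      then show "sg c a \<in> {y s0 | y. y \<in> M}" using M_scale by force
    qed
  next
    fix z a assume "a \<in> {y s0 | y. y \<in> M}"
    then show "br z a \<in> {y s0 | y. y \<in> M}" using M_bracket by force
  qed
  moreover have "{y s0 | y. y \<in> M} \<noteq> UNIV"
  proof
    assume all: "{y s0 | y. y \<in> M} = UNIV"
    have "\<exists>y. y \<in> M \<and> y s0 = z" for z
    proof -
      have "z \<in> {y s0 | y. y \<in> M}" unfolding all by simp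
      then show ?thesis by blast
    qed
    then obtain Y where Y: "\<And>z. Y z \<in> M" "\<And>z. Y z s0 = z" by metis
    \<comment> \<open>The tuples compared below agree at \<open>s0\<close>, so
      \<open>M_unique\<close> makes each coordinate of \<open>Y\<close> linear and
      equivariant.\<close>
    have "\<exists>c. \<forall>z. Y z s = sg c z" if s: "s \<in> ?G" for s
    proof (rule schur)
      show "Vector_Spaces.linear sg sg (\<lambda>z. Y z s)"
      proof (rule linear_mapI[OF vector_space_axioms vector_space_axioms])
        show "Y (z + z') s = Y z s + Y z' s" for z z'
          by (rule M_unique[OF Y(1) M_add[OF Y(1) Y(1)] _ s]) (simp only: Y(2))
        show "Y (sg c z) s = sg c (Y z s)" for c z
          by (rule M_unique[OF Y(1) M_scale[OF Y(1)] _ s]) (simp only: Y(2))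
      qed
      show "Y (br x z) s = br x (Y z s)" for x z
        by (rule M_unique[OF Y(1) M_bracket[OF Y(1)] _ s]) (simp only: Y(2))
    qed
    then obtain c where c: "\<And>s z. s \<in> ?G \<Longrightarrow> Y z s = sg (c s) z" by metis
    have "z \<otimes> (\<Sum>s\<in>?G. ss (c s) s) = (\<Sum>s\<in>?G. Y z s \<otimes> s)" for z
      unfolding tens_sum by (rule sum.cong) (simp_all add: c tens_simps)
    then have "(\<Sum>s\<in>?G. ss (c s) s) \<in> coeff_ideal K"
      using Y(1) by (simp add: coeff_ideal_def M_def)
    \<comment> \<open>This contradicts \<open>Y z s0 = z\<close>, by which the scalar at
      \<open>s0\<close> acts as the identity.\<close>
    then have "c s0 = 0" using insert.prems(1) by blast
    then have "z = 0" for z :: 'g using c[of s0 z] Y(2)[of z] by simp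
    then show False using not_abelian by metis
  qed
  ultimately have "{y s0 | y. y \<in> M} = {0}" using ideal_trivial by blast
  moreover have "y \<in> M" using insert.prems(2) by (simp add: M_def)
  ultimately show ?case using M_eq_0[of y s] insert.prems(3) by blast
qed

text \<open>A basis \<open>C\<close> of the coefficient ideal is extended to a basis
  \<open>B\<close> of the ring, and an element of \<open>K\<close> is split along \<open>C\<close>
  and \<open>B - C\<close>. The first part lies in \<open>K\<close>, hence so does the second. As
  \<open>B - C\<close> is independent modulo the coefficient ideal, \<open>coefficients_eq_0\<close>
  makes the second part vanish.\<close>

lemma ideal_eq_tensor_sub: "K = tensor_sub sg ss UNIV (coeff_ideal K)"
proof
  show "tensor_sub sg ss UNIV (coeff_ideal K) \<subseteq> K"
    unfolding tensor_sub_def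
    by (rule vt.span_minimal[OF _ K_subspace]) (auto simp: coeff_ideal_def)
  show "K \<subseteq> tensor_sub sg ss UNIV (coeff_ideal K)"
  proof
    fix t assume tK: "t \<in> K"
    obtain C where C: "C \<subseteq> coeff_ideal K" "S.independent C" "coeff_ideal K \<subseteq> S.span C"
      by (rule S.maximal_independent_subset)
    obtain B where B: "C \<subseteq> B" "S.independent B" "UNIV \<subseteq> S.span B"
      by (rule S.maximal_independent_subset_extend[OF subset_UNIV C(2)])
    have pure: "x \<otimes> r \<in> vt.span {x \<otimes> b | x b. b \<in> B}" for x r
    proof -
      have "r \<in> S.span B" using B(3) by blast
      then show ?thesis
      proof (induction rule: S.span_induct_alt)
        case base
        show ?case unfolding tens_0 by (rule vt.span_zero)
      next
        case (step c b r)
        have "x \<otimes> b \<in> vt.span {x \<otimes> b | x b. b \<in> B}"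
          by (rule vt.span_base) (use step(1) in blast)
        from vt.span_add[OF vt.span_scale[OF this] step(2)] show ?case unfolding tens_simps .
      qed
    qed
    have "t \<in> vt.span {x \<otimes> r | x r. x \<in> UNIV \<and> r \<in> UNIV}"
      using tK K_current unfolding tensor_sub_def by blast
    also have "\<dots> \<subseteq> vt.span {x \<otimes> b | x b. b \<in> B}"
      by (rule vt.span_minimal) (use pure in auto)
    also have "{x \<otimes> b | x b. b \<in> B} = {x \<otimes> b | x b. b \<in> C} \<union> {x \<otimes> b | x b. b \<in> B - C}"
      using B(1) by blast
    finally obtain t1 t2 where t: "t = t1 + t2" and t1: "t1 \<in> vt.span {x \<otimes> b | x b. b \<in> C}"
      and t2: "t2 \<in> vt.span {x \<otimes> b | x b. b \<in> B - C}"
      unfolding vt.span_Un by blast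
    have "vt.span {x \<otimes> b | x b. b \<in> C} \<subseteq> tensor_sub sg ss UNIV (coeff_ideal K)"
      unfolding tensor_sub_def using C(1) by (intro vt.span_mono) blast
    with t1 have t1': "t1 \<in> tensor_sub sg ss UNIV (coeff_ideal K)" by blast
    with \<open>tensor_sub sg ss UNIV (coeff_ideal K) \<subseteq> K\<close> have "t1 \<in> K" by blast
    with tK have t2K: "t2 \<in> K" using vt.subspace_diff[OF K_subspace, of t t1] t by simp
    obtain F y where F: "finite F" "F \<subseteq> B - C" "t2 = (\<Sum>b\<in>F. y b \<otimes> b)"
      using tens_span_decomposition[OF t2] by blast
    have "\<forall>s\<in>F. c s = 0" if c: "(\<Sum>s\<in>F. ss (c s) s) \<in> coeff_ideal K" for c
    proof
      fix b assume b: "b \<in> F"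
      interpret pair: vector_space_pair ss "(*) :: 'k \<Rightarrow> 'k \<Rightarrow> 'k"
        using S.vector_space_axioms vector_space_mult by (simp add: vector_space_pair_def)
      \<comment> \<open>The coordinate form of \<open>b\<close> kills the span of \<open>C\<close>,
        which contains the coefficient ideal, and reads off \<open>c b\<close>.\<close>
      obtain l where l: "Vector_Spaces.linear ss (*) l" "\<forall>x\<in>B. l x = (if x = b then 1 else 0 :: 'k)"
        using pair.linear_independent_extend[OF B(2), of "\<lambda>x. if x = b then 1 else 0"] by blast
      interpret l: Vector_Spaces.linear ss "(*)" l by (rule l(1))
      have "l x = 0" if "x \<in> S.span C" for x
        using that
      proof (induction rule: S.span_induct_alt)
        case base
        show ?case by (rule l.zero)
      next
        case (step a x z)
        have "x \<in> B" "x \<noteq> b" using step(1) B(1) F(2) b by blast+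
        then have "l x = 0" using l(2) by simp
        with step show ?case by (simp add: l.add l.scale)
      qed
      then have "l (\<Sum>s\<in>F. ss (c s) s) = 0" using c C(3) by blast
      moreover have "l (\<Sum>s\<in>F. ss (c s) s) = (\<Sum>s\<in>F. if s = b then c s else 0)"
        unfolding l.sum l.scale using l(2) F(2) by (intro sum.cong) auto
      ultimately show "c b = 0" using F(1) b by simp
    qed
    from coefficients_eq_0[OF F(1) this] have "y s = 0" if "s \<in> F" for s
      using t2K that unfolding F(3) by blast
    then have "t2 = 0" unfolding F(3) by (intro sum.neutral) (simp add: tens_0)
    with t1' t show "t \<in> tensor_sub sg ss UNIV (coeff_ideal K)" by simp
  qed
qed

end

text \<open>For \<open>s\<close> in \<open>P\<close> but not in \<open>Q\<close>, choose linear
  forms with \<open>m s = 1\<close>, \<open>m\<close> zero on \<open>Q\<close>, and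
  \<open>l x = 1\<close>. Tensors are functions of bilinear forms, and evaluation at the product of
  \<open>l\<close> and \<open>m\<close> separates \<open>x \<otimes> s\<close> from the tensors over
  \<open>Q\<close>. This gives uniqueness of the ideal in \<open>kernel_ideal\<close>.\<close>

lemma tensor_sub_UNIV_mono_iff:
  assumes "S.subspace P" "S.subspace Q" "tensor_sub sg ss UNIV P \<subseteq> tensor_sub sg ss UNIV Q"
  shows "P \<subseteq> Q"
proof
  fix s assume s: "s \<in> P"
  show "s \<in> Q"
  proof (rule ccontr)
    assume "s \<notin> Q"
    interpret pairS: vector_space_pair ss "(*) :: 'k \<Rightarrow> 'k \<Rightarrow> 'k"
      using S.vector_space_axioms vector_space_mult by (simp add: vector_space_pair_def)
    interpret pair: vector_space_pair sg "(*) :: 'k \<Rightarrow> 'k \<Rightarrow> 'k"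
      using vector_space_axioms vector_space_mult by (simp add: vector_space_pair_def)
    obtain C where C: "C \<subseteq> Q" "S.independent C" "Q \<subseteq> S.span C"
      by (rule S.maximal_independent_subset)
    have "s \<notin> S.span C"
      using \<open>s \<notin> Q\<close> S.span_minimal[OF C(1) assms(2)] by blast
    then have "S.independent (insert s C)" by (rule S.independent_insertI[OF _ C(2)])
    from pairS.linear_independent_extend[OF this, of "\<lambda>x. if x = s then 1 else 0"]
    obtain m where m: "Vector_Spaces.linear ss (*) m" "\<forall>x\<in>insert s C. m x = (if x = s then 1 else 0 :: 'k)"
      by blast
    interpret m: Vector_Spaces.linear ss "(*)" m by (rule m(1))
    obtain x :: 'g where x: "x \<noteq> 0" using not_abelian by metis
    then have "independent {x}" by simp
    from pair.linear_independent_extend[OF this, of "\<lambda>_. 1"]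
    obtain l where l: "Vector_Spaces.linear sg (*) l" "l x = (1 :: 'k)" by blast
    interpret l: Vector_Spaces.linear sg "(*)" l by (rule l(1))
    define B where "B = (\<lambda>y r. l y * m r)"
    have B: "bilinear_map sg ss (*) B"
      unfolding bilinear_map_iff[OF vector_space_axioms S.vector_space_axioms vector_space_mult]
      unfolding B_def l.add l.scale m.add m.scale
      by (simp only: distrib_left distrib_right mult.assoc mult.left_commute simp_thms)
    have mQ: "m r = 0" if "r \<in> Q" for r
    proof -
      have "r \<in> S.span C" using that C(3) by blast
      then show ?thesis
      proof (induction rule: S.span_induct_alt)
        case base
        show ?case by (rule m.zero)
      next
        case (step a b z)
        then have "m b = 0" using m(2) \<open>s \<notin> S.span C\<close> S.span_base[of b C] by auto
        with step show ?case by (simp add: m.add m.scale)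
      qed
    qed
    have zero: "t B = 0" if "t \<in> tensor_sub sg ss UNIV Q" for t
      using that unfolding tensor_sub_def
    proof (induction rule: vt.span_induct_alt)
      case base
      show ?case by simp
    next
      case (step c t u)
      then obtain y r where "t = y \<otimes> r" "r \<in> Q" by blast
      then have "t B = 0" using B mQ by (simp add: tensor_def B_def)
      with step show ?case by (simp add: tensor_scale_def)
    qed
    have "x \<otimes> s \<in> tensor_sub sg ss UNIV P"
      unfolding tensor_sub_def using s by (intro vt.span_base) blast
    with zero assms(3) have "(x \<otimes> s) B = 0" by blast
    then show False using B l(2) m(2) by (simp add: tensor_def B_def)
  qed
qed

text \<open>Scaling by \<open>c\<close> is multiplication by the ring element
  \<open>ss c 1\<close>.\<close>

lemma ring_ideal_subspace:
  assumes "ring_ideal P"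
  shows "S.subspace P"
proof (rule S.subspaceI)
  show "0 \<in> P" and "\<And>x y. x \<in> P \<Longrightarrow> y \<in> P \<Longrightarrow> x + y \<in> P"
    using assms by (auto simp: ring_ideal_def)
  fix c x assume "x \<in> P"
  then have "ss c 1 * x \<in> P" using assms by (auto simp: ring_ideal_def)
  then show "ss c x \<in> P" by (simp flip: S.scale_mult)
qed

end

section \<open>The kernel of a module over the current algebra\<close>

locale current_algebra_module = current_algebra sg br ss + current_module sg br ss sv \<phi>
  for sg :: "'k::alg_closed_field \<Rightarrow> 'g::ab_group_add \<Rightarrow> 'g"
    and br :: "'g \<Rightarrow> 'g \<Rightarrow> 'g"
    and ss :: "'k \<Rightarrow> 's::{comm_ring,comm_monoid_mult} \<Rightarrow> 's"
    and sv :: "'k \<Rightarrow> 'v::ab_group_add \<Rightarrow> 'v"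
    and \<phi> :: "('k, 'g, 's) tensor \<Rightarrow> 'v \<Rightarrow> 'v"
begin

sublocale V: vector_space sv by (rule module_vector_space)

abbreviation act where "act x s v \<equiv> \<phi> (x \<otimes> s) v"

lemma act_simps:
  "act (x + y) s v = act x s v + act y s v" "act x (s + r) v = act x s v + act x r v"
  "act (sg c x) s v = sv c (act x s v)" "act x (ss c s) v = sv c (act x s v)"
  "act x s (v + w) = act x s v + act x s w" "act x s (sv c v) = sv c (act x s v)"
  using action_linear[OF tens_in_current, of x s]
  by (simp_all add: tens_simps action_add action_scale tens_in_current
      linear_iff_on[OF module_vector_space module_vector_space])

lemma act_0: "act 0 s v = 0" "act x 0 v = 0" "act x s 0 = 0"
  using act_simps(3)[of 0 0 s v] act_simps(4)[of x 0 0 v] act_simps(6)[of x s 0 0]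
  by simp_all

lemma act_bracket: "act (br x y) (s * r) v = act x s (act y r v) - act y r (act x s v)"
  using action_bracket[OF tens_in_current tens_in_current, of x s y r v]
  by (simp add: tens_bracket)

definition annihilator :: "'s set" where "annihilator = {s. \<forall>x v. act x s v = 0}"

text \<open>The kernel of the action is an ideal whose coefficient ideal is
  \<open>annihilator\<close>. Existence comes from \<open>ideal_eq_tensor_sub\<close>, uniqueness
  from \<open>tensor_sub_UNIV_mono_iff\<close>.\<close>

lemma kernel_ideal_eq_annihilator:
  "ring_ideal annihilator" "kernel_ideal sg ss \<phi> = annihilator"
proof -
  let ?K = "{a \<in> current. \<forall>v. \<phi> a v = 0}"
  have \<phi>0: "\<phi> 0 v = 0" for v
    using act_0(1)[of 0 v] unfolding tens_0 .
  have sub: "vt.subspace ?K"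
    by (rule vt.subspaceI)
      (auto simp: action_add action_scale \<phi>0 intro: vt.subspace_0[OF subspace_current]
        vt.subspace_add[OF subspace_current] vt.subspace_scale[OF subspace_current])
  have br: "tensor_bracket sg br ss (z \<otimes> r) t \<in> ?K" if "t \<in> ?K" for z r t
    using that tensor_bracket_closed[OF lie_algebra_axioms S.comm_algebra_axioms tens_in_current, of t z r]
    by (simp add: action_bracket tens_in_current act_0)
  have coeff: "coeff_ideal ?K = annihilator"
    by (auto simp: coeff_ideal_def annihilator_def tens_in_current)
  show ideal: "ring_ideal annihilator"
    using ring_ideal_coeff_ideal[OF sub _ br] unfolding coeff by blast
  have K: "?K = tensor_sub sg ss UNIV annihilator"
    using ideal_eq_tensor_sub[OF sub _ br] unfolding coeff by blast
  show "kernel_ideal sg ss \<phi> = annihilator"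
    unfolding kernel_ideal_def
  proof (rule the_equality)
    show "ring_ideal annihilator \<and> ?K = tensor_sub sg ss UNIV annihilator"
      using ideal K by blast
    fix P assume P: "ring_ideal P \<and> ?K = tensor_sub sg ss UNIV P"
    then show "P = annihilator"
      using K tensor_sub_UNIV_mono_iff[of P annihilator] tensor_sub_UNIV_mono_iff[of annihilator P]
        ring_ideal_subspace ideal by blast
  qed
qed

end


section \<open>Simple weight modules\<close>

text \<open>Finite codimension is expressed by finitely many vectors whose span represents
  everything modulo the common kernel. In the induction step, \<open>B\<close> does this for the old
  kernel \<open>U\<close>; adding lifts \<open>D\<close> to \<open>U\<close> of a basis of its image
  under the new map does it for the new one.\<close>

lemma (in vector_space_pair) finite_codim_common_kernel:
  assumes "finite I" and "\<And>i. i \<in> I \<Longrightarrow> Vector_Spaces.linear s1 s2 (f i)"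
    and "\<And>i. i \<in> I \<Longrightarrow> \<exists>C. finite C \<and> range (f i) \<subseteq> vs2.span C"
  shows "\<exists>B. finite B \<and> (\<forall>s. \<exists>b\<in>vs1.span B. \<forall>i\<in>I. f i (s - b) = 0)"
  using assms
proof (induction I)
  case empty
  show ?case using vs1.span_zero by (intro exI[of _ "{}"]) auto
next
  case (insert i I)
  then obtain B where B: "finite B" "\<And>s. \<exists>b\<in>vs1.span B. \<forall>j\<in>I. f j (s - b) = 0"
    by (metis insertCI)
  interpret fi: Vector_Spaces.linear s1 s2 "f i" using insert.prems(1) by simp
  define U where "U = {u. \<forall>j\<in>I. f j u = 0}"
  have U: "vs1.subspace U"
  proof (rule vs1.subspaceI)
    have "f j 0 = 0" if "j \<in> I" for j
    proof -
      interpret fj: Vector_Spaces.linear s1 s2 "f j" using insert.prems(1) that by simp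
      show ?thesis by (rule fj.zero)
    qed
    then show "0 \<in> U" by (simp add: U_def)
  next
    fix x y assume "x \<in> U" "y \<in> U"
    moreover have "f j (x + y) = f j x + f j y" if "j \<in> I" for j
    proof -
      interpret fj: Vector_Spaces.linear s1 s2 "f j" using insert.prems(1) that by simp
      show ?thesis by (rule fj.add)
    qed
    ultimately show "x + y \<in> U" by (simp add: U_def)
  next
    fix c x assume "x \<in> U"
    moreover have "f j (s1 c x) = s2 c (f j x)" if "j \<in> I" for j
    proof -
      interpret fj: Vector_Spaces.linear s1 s2 "f j" using insert.prems(1) that by simp
      show ?thesis by (rule fj.scale)
    qed
    ultimately show "s1 c x \<in> U" by (simp add: U_def)
  qed
  obtain C where C: "finite C" "range (f i) \<subseteq> vs2.span C"
    using insert.prems(2)[of i] by auto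
  obtain Q where Q: "Q \<subseteq> f i ` U" "vs2.independent Q" "f i ` U \<subseteq> vs2.span Q"
    by (rule vs2.maximal_independent_subset)
  have "Q \<subseteq> vs2.span C" using Q(1) C(2) by blast
  then have "finite Q" using vs2.independent_span_bound[OF C(1) Q(2)] by blast
  then obtain D where D: "D \<subseteq> U" "finite D" "Q = f i ` D"
    using finite_subset_image[OF _ Q(1)] by blast
  have DU: "vs1.span D \<subseteq> U" using D(1) U by (rule vs1.span_minimal)
  have "\<exists>b\<in>vs1.span (B \<union> D). \<forall>j\<in>insert i I. f j (s - b) = 0" for s
  proof -
    obtain b where b: "b \<in> vs1.span B" "s - b \<in> U" using B(2)[of s] by (auto simp: U_def)
    have "f i (s - b) \<in> f i ` vs1.span D"
      using b(2) Q(3) by (simp add: D(3) fi.span_image subset_iff)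
    then obtain d where d: "d \<in> vs1.span D" "f i (s - b) = f i d" by auto
    then have "s - b - d \<in> U" using b(2) DU vs1.subspace_diff[OF U, of "s - b" d] by blast
    moreover have "f i (s - b - d) = 0" using d(2) by (simp add: fi.diff)
    ultimately have "\<forall>j\<in>insert i I. f j (s - (b + d)) = 0"
      by (simp add: U_def diff_diff_eq)
    moreover have "b + d \<in> vs1.span (B \<union> D)"
      using b(1) d(1) vs1.span_mono[of B "B \<union> D"] vs1.span_mono[of D "B \<union> D"]
      by (intro vs1.span_add) auto
    ultimately show ?thesis by blast
  qed
  then show ?case using B(1) D(2) by (intro exI[of _ "B \<union> D"]) simp
qed

section \<open>Weight decomposition and the action of the Cartan subalgebra\<close>

locale simple_weight_module =
  current_algebra_module sg br ss sv \<phi> + simple_current_module sg br ss sv \<phi>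
  for sg :: "'k::alg_closed_field \<Rightarrow> 'g::ab_group_add \<Rightarrow> 'g"
    and br :: "'g \<Rightarrow> 'g \<Rightarrow> 'g"
    and ss :: "'k \<Rightarrow> 's::{comm_ring,comm_monoid_mult} \<Rightarrow> 's"
    and sv :: "'k \<Rightarrow> 'v::ab_group_add \<Rightarrow> 'v"
    and \<phi> :: "('k, 'g, 's) tensor \<Rightarrow> 'v \<Rightarrow> 'v" +
  fixes h :: "'g set"
  assumes cartan: "cartan_subalgebra sg br h"
    and weight_module: "weight_module sg h ss sv \<phi>"
begin

abbreviation "W \<equiv> weight_space sg h ss sv \<phi>"
abbreviation "hdual \<equiv> dual_on sg h"

lemma subspace_h: "subspace h"
  and normalizer_h: "(\<forall>y\<in>h. br x y \<in> h) \<Longrightarrow> x \<in> h"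
  using cartan unfolding cartan_subalgebra_def by blast+

lemma hdual_add: "\<mu> \<in> hdual \<Longrightarrow> \<nu> \<in> hdual \<Longrightarrow> \<mu> + \<nu> \<in> hdual"
  by (auto simp: dual_on_def algebra_simps)

lemma hdual_0: "0 \<in> hdual"
  by (simp add: dual_on_def)

lemma weight_spaceD: "v \<in> W \<mu> \<Longrightarrow> y \<in> h \<Longrightarrow> act y 1 v = sv (\<mu> y) v"
  by (simp add: weight_space_def)

lemma subspace_weight_space: "V.subspace (W \<mu>)"
  by (rule V.subspaceI)
    (auto simp: weight_space_def act_simps act_0 V.scale_right_distrib mult.commute)

lemma weight_decomposition:
  "\<exists>!f. (\<forall>i\<in>hdual. f i \<in> W i) \<and> (\<forall>i. i \<notin> hdual \<longrightarrow> f i = 0) \<and>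
     finite {i. f i \<noteq> 0} \<and> v = (\<Sum>i | f i \<noteq> 0. f i)"
  using weight_module by (simp add: weight_module_def direct_sum_decomposition_def)

text \<open>Uniqueness of the decomposition of 0, stated for any finite index set that contains the
  support.\<close>

lemma weight_components_eq_0:
  assumes "\<And>i. i \<in> hdual \<Longrightarrow> g i \<in> W i" "\<And>i. i \<notin> hdual \<Longrightarrow> g i = 0"
    and F: "finite F" "\<And>i. g i \<noteq> 0 \<Longrightarrow> i \<in> F" "(\<Sum>i\<in>F. g i) = 0"
  shows "g i = 0"
proof -
  define P where "P f \<longleftrightarrow> (\<forall>i\<in>hdual. f i \<in> W i) \<and> (\<forall>i. i \<notin> hdual \<longrightarrow> f i = 0) \<and>
     finite {i. f i \<noteq> 0} \<and> 0 = (\<Sum>i | f i \<noteq> 0. f i)" for f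
  have "finite {i. g i \<noteq> 0}" using F by (auto intro: finite_subset[of _ F])
  moreover have "(\<Sum>i | g i \<noteq> 0. g i) = (\<Sum>i\<in>F. g i)"
    using F by (intro sum.mono_neutral_left) auto
  ultimately have "P g" using assms by (simp add: P_def)
  moreover have "P (\<lambda>_. 0)"
    using V.subspace_0[OF subspace_weight_space] by (simp add: P_def)
  moreover have "\<exists>!f. P f" using weight_decomposition[of 0] by (simp add: P_def)
  ultimately have "g = (\<lambda>_. 0)" by blast
  then show ?thesis by simp
qed

lemma weight_spaces_span:
  assumes A: "V.subspace A" "\<And>\<mu>. \<mu> \<in> hdual \<Longrightarrow> W \<mu> \<subseteq> A"
  shows "v \<in> A"
proof -
  obtain f where f: "\<forall>i\<in>hdual. f i \<in> W i" "\<forall>i. i \<notin> hdual \<longrightarrow> f i = 0" "v = (\<Sum>i | f i \<noteq> 0. f i)"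
    using weight_decomposition[of v] by blast
  have "f i \<in> A" if "f i \<noteq> 0" for i using f(1,2) A(2) that by blast
  then show ?thesis unfolding f(3) by (intro V.subspace_sum[OF A(1)]) simp
qed

text \<open>On the component of weight \<open>i\<close>, the operator y - d is the scalar
  \<open>i y - d\<close>. If its square kills a component, so does the scalar itself.\<close>

lemma cartan_acts_semisimply:
  assumes y: "y \<in> h" and sq: "act y 1 (act y 1 u - sv d u) = sv d (act y 1 u - sv d u)"
  shows "act y 1 u = sv d u"
proof -
  obtain f where f: "\<forall>i\<in>hdual. f i \<in> W i" "\<forall>i. i \<notin> hdual \<longrightarrow> f i = 0"
      "finite {i. f i \<noteq> 0}" "u = (\<Sum>i | f i \<noteq> 0. f i)"
    using weight_decomposition[of u] by blast
  interpret Y: Vector_Spaces.linear sv sv "act y 1" by (rule action_linear[OF tens_in_current])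
  let ?F = "{i. f i \<noteq> 0}"
  have Yf: "act y 1 (f i) = sv (i y) (f i)" if "i \<in> ?F" for i
    using f(1,2) that y by (intro weight_spaceD) auto
  have 1: "act y 1 u - sv d u = (\<Sum>i\<in>?F. sv (i y - d) (f i))"
    unfolding f(4) Y.sum V.scale_sum_right sum_subtractf[symmetric]
    by (intro sum.cong refl) (simp add: Yf V.scale_left_diff_distrib)
  have "(\<Sum>i\<in>?F. sv ((i y - d) * (i y - d)) (f i)) =
      act y 1 (act y 1 u - sv d u) - sv d (act y 1 u - sv d u)"
    unfolding 1 Y.sum V.scale_sum_right sum_subtractf[symmetric]
  proof (intro sum.cong refl)
    fix i assume "i \<in> ?F"
    moreover have "(i y - d) * (i y - d) = (i y - d) * i y - d * (i y - d)"
      by (simp add: algebra_simps)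
    ultimately show "sv ((i y - d) * (i y - d)) (f i) =
        act y 1 (sv (i y - d) (f i)) - sv d (sv (i y - d) (f i))"
      \<comment> \<open>The instance splits only differences of products, so that the scalar
        \<open>i y - d\<close> stays whole.\<close>
      by (simp only: Y.scale Yf V.scale_scale V.scale_left_diff_distrib[of "_ * _" "_ * _"])
  qed
  also have "\<dots> = 0" using sq by simp
  finally have sum0: "(\<Sum>i\<in>?F. sv ((i y - d) * (i y - d)) (f i)) = 0" .
  have "sv ((i y - d) * (i y - d)) (f i) = 0" for i
    by (rule weight_components_eq_0[where F = ?F and g = "\<lambda>i. sv ((i y - d) * (i y - d)) (f i)"])
      (use f sum0 in \<open>auto intro: V.subspace_scale[OF subspace_weight_space]\<close>)
  then have "sv (i y - d) (f i) = 0" for i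
    by (metis V.scale_eq_0_iff mult_eq_0_iff)
  then have "(\<Sum>i\<in>?F. sv (i y - d) (f i)) = 0" by (intro sum.neutral) blast
  then show ?thesis using 1 by simp
qed

text \<open>Moving \<open>y\<close> past \<open>x\<close> costs \<open>br y x\<close>, which is
  \<open>\<beta> y\<close> times \<open>x\<close>.\<close>

lemma act_root_space:
  assumes "x \<in> root_space sg br h \<beta>" "v \<in> W \<mu>"
  shows "act x s v \<in> W (\<mu> + \<beta>)"
  unfolding weight_space_def
proof (intro CollectI ballI)
  fix y assume y: "y \<in> h"
  have "act y 1 (act x s v) = act (br y x) (1 * s) v + act x s (act y 1 v)"
    unfolding act_bracket by simp
  also have "\<dots> = sv ((\<mu> + \<beta>) y) (act x s v)"
    using assms y by (simp add: root_space_def weight_spaceD act_simps V.scale_left_distrib)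
  finally show "act y 1 (act x s v) = sv ((\<mu> + \<beta>) y) (act x s v)" .
qed

text \<open>The elements \<open>x\<close> for which \<open>x \<otimes> 1\<close> acts by zero form
  an ideal. If it is everything, then \<open>br x y \<otimes> s\<close>, the bracket of
  \<open>x \<otimes> 1\<close> and \<open>y \<otimes> s\<close>, also acts by zero.\<close>

lemma faithful_or_trivial:
  "(\<forall>x. (\<forall>v. act x 1 v = 0) \<longrightarrow> x = 0) \<or> (\<forall>x s v. act x s v = 0)"
proof -
  let ?N = "{x. \<forall>v. act x 1 v = 0}"
  have "lie_ideal sg br ?N"
    unfolding lie_ideal_def
  proof (intro conjI allI ballI)
    show "subspace ?N" by (rule subspaceI) (simp_all add: act_simps act_0)
    show "br x a \<in> ?N" if "a \<in> ?N" for x a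
      using that act_bracket[of x a 1 1] by (simp add: act_0)
  qed
  then consider "?N = {0}" | "?N = UNIV" using ideal_trivial by blast
  then show ?thesis
  proof cases
    case 1
    then show ?thesis by blast
  next
    case 2
    then have triv: "act x 1 v = 0" for x v by blast
    have "subspace {x. \<forall>s v. act x s v = 0}"
      by (rule subspaceI) (simp_all add: act_simps act_0)
    moreover have "{br x y | x y. True} \<subseteq> {x. \<forall>s v. act x s v = 0}"
      using act_bracket[of _ _ 1] by (auto simp: triv act_0)
    ultimately have "span {br x y | x y. True} \<subseteq> {x. \<forall>s v. act x s v = 0}"
      by (rule span_minimal[rotated])
    then show ?thesis unfolding span_brackets by blast
  qed
qed

section \<open>Root vectors of the Lie algebra under a faithful action\<close>

context
  assumes faithful: "\<And>x. (\<And>v. act x 1 v = 0) \<Longrightarrow> x = 0"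
begin

lemma zero_on_weight_spaces:
  assumes "\<And>\<mu> v. \<mu> \<in> hdual \<Longrightarrow> v \<in> W \<mu> \<Longrightarrow> act x 1 v = 0"
  shows "x = 0"
proof (rule faithful)
  fix v
  have "V.subspace {v. act x 1 v = 0}"
    by (rule V.subspaceI) (simp_all add: act_simps act_0)
  then have "v \<in> {v. act x 1 v = 0}" by (rule weight_spaces_span) (use assms in blast)
  then show "act x 1 v = 0" by simp
qed

text \<open>Both elements act by scalars on each weight space, so their bracket acts by zero
  there.\<close>

lemma cartan_abelian:
  assumes "y \<in> h" "z \<in> h"
  shows "br y z = 0"
proof (rule zero_on_weight_spaces)
  fix \<mu> v assume "v \<in> W \<mu>"
  then show "act (br y z) 1 v = 0"
    using assms act_bracket[of y z 1 1 v] by (simp add: weight_spaceD act_simps mult.commute)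
qed

text \<open>Semisimplicity passes from the module to the adjoint action: for \<open>v\<close> of
  weight \<open>\<mu>\<close> and u = xv, the element \<open>br y x - sg c x\<close> sends
  \<open>v\<close> to (y - d)u with d = \<open>\<mu> y + c\<close>, so
  \<open>cartan_acts_semisimply\<close> applies to u.\<close>

lemma ad_cartan_semisimple:
  assumes y: "y \<in> h" and sq: "br y (br y x - sg c x) = sg c (br y x - sg c x)"
  shows "br y x = sg c x"
proof -
  have diff: "act (a - b) 1 v = act a 1 v - act b 1 v" for a b v
    using act_simps(1)[of "a - b" b 1 v] by (simp add: algebra_simps)
  define z where "z = br y x - sg c x"
  have "z = 0"
  proof (rule zero_on_weight_spaces)
    fix \<mu> v assume v: "v \<in> W \<mu>"
    define u where "u = act x 1 v"
    have br: "act (br y a) 1 v = act y 1 (act a 1 v) - sv (\<mu> y) (act a 1 v)" for a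
      using act_bracket[of y a 1 1 v] v y by (simp add: weight_spaceD act_simps)
    have 1: "act z 1 v = act y 1 u - sv (\<mu> y + c) u"
      by (simp add: z_def diff br act_simps u_def V.scale_left_distrib)
    have "br y z = sg c z" using sq by (simp add: z_def)
    then have "act y 1 (act z 1 v) = sv (\<mu> y + c) (act z 1 v)"
      using br[of z] by (simp add: act_simps V.scale_left_distrib algebra_simps)
    then have "act y 1 u = sv (\<mu> y + c) u"
      unfolding 1 by (rule cartan_acts_semisimply[OF y])
    then show "act z 1 v = 0" by (simp add: 1)
  qed
  then show ?thesis by (simp add: z_def)
qed

text \<open>The maps \<open>br y\<close> with \<open>y \<in> h\<close> commute, by the Jacobi
  identity and \<open>cartan_abelian\<close>, and are semisimple.\<close>

lemma root_vectors_span: "span {x. \<forall>y\<in>h. \<exists>c. br y x = sg c x} = UNIV"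
proof -
  obtain B where "finite_dimensional_vector_space sg B"
    using fin_dim_on_UNIV_basis[OF vector_space_axioms fin_dim] by blast
  then interpret g: alg_closed_vector_space sg B by (simp add: alg_closed_vector_space_def)
  have "UNIV \<subseteq> span {x \<in> UNIV. \<forall>T\<in>br ` h. \<exists>c. T x = sg c x}"
  proof (rule g.span_joint_eigenvectors)
    show "Vector_Spaces.linear sg sg T" if "T \<in> br ` h" for T
      using that bracket_linear_right by blast
    show "T (T' x) = T' (T x)" if TT: "T \<in> br ` h" "T' \<in> br ` h" for T T' x
    proof -
      obtain y z where yz: "T = br y" "T' = br z" "y \<in> h" "z \<in> h" using TT by blast
      have "br y (br z x) - br z (br y x) = 0"
        using jacobi[of y z x] cartan_abelian[OF yz(3,4)] bracket_antisym[of x y]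
        by (simp add: bracket_0 bracket_minus)
      then show ?thesis by (simp add: yz)
    qed
    show "T x = sg c x" if "T \<in> br ` h" "T (T x - sg c x) = sg c (T x - sg c x)" for T c x
      using that ad_cartan_semisimple by blast
  qed simp_all
  then show ?thesis by (simp add: top.extremum_uniqueI)
qed

text \<open>Eigenvalues of a nonzero vector are unique, hence linear in \<open>y\<close>. Both
  memberships are recorded: \<open>graded_piece\<close>, which is \<open>h\<close> at weight 0,
  enters the sets J, while \<open>root_space\<close> gives the shift of weights.\<close>

lemma root_vector_weight:
  assumes x: "x \<noteq> 0" "\<forall>y\<in>h. \<exists>c. br y x = sg c x"
  shows "\<exists>\<beta>\<in>roots sg br h \<union> {0}. x \<in> graded_piece sg br h \<beta> \<and> x \<in> root_space sg br h \<beta>"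
proof -
  define \<beta> where "\<beta> = (\<lambda>y. if y \<in> h then SOME c. br y x = sg c x else 0)"
  have \<beta>: "br y x = sg (\<beta> y) x" if "y \<in> h" for y
    using someI_ex[OF x(2)[rule_format, OF that]] that by (simp add: \<beta>_def)
  have \<beta>_eqI: "\<beta> y = c" if "y \<in> h" "br y x = sg c x" for y c
    using \<beta>[OF that(1)] that(2) x(1) by simp
  have "\<beta> \<in> hdual"
    unfolding dual_on_def
  proof (intro CollectI conjI ballI allI impI)
    show "\<beta> (a + b) = \<beta> a + \<beta> b" if "a \<in> h" "b \<in> h" for a b
      using that subspace_add[OF subspace_h]
      by (intro \<beta>_eqI) (auto simp: bracket_simps \<beta> scale_left_distrib)
    show "\<beta> (sg c a) = c * \<beta> a" if "a \<in> h" for a c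
      using that subspace_scale[OF subspace_h]
      by (intro \<beta>_eqI) (auto simp: bracket_simps \<beta>)
    show "\<beta> a = 0" if "a \<notin> h" for a using that by (simp add: \<beta>_def)
  qed
  moreover have R: "x \<in> root_space sg br h \<beta>" using \<beta> by (simp add: root_space_def)
  \<comment> \<open>At weight 0, \<open>x\<close> centralizes \<open>h\<close>, which is its own
    normalizer.\<close>
  moreover have "x \<in> h" if "\<beta> = 0"
  proof (rule normalizer_h, rule ballI)
    fix y assume "y \<in> h"
    then have "br x y = 0" using \<beta>[of y] bracket_antisym[of x y] that by simp
    then show "br x y \<in> h" using subspace_0[OF subspace_h] by simp
  qed
  ultimately have "\<beta> \<in> roots sg br h \<union> {0}" "x \<in> graded_piece sg br h \<beta>"
    using x(1) by (auto simp: roots_def graded_piece_def)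
  with R show ?thesis by blast
qed

text \<open>Independence of \<open>X\<close> gives finiteness and excludes 0, as
  \<open>root_vector_weight\<close> requires.\<close>

lemma finite_homogeneous_spanning_set:
  "\<exists>X \<beta>. finite X \<and> span X = UNIV \<and> (\<forall>x\<in>X. \<beta> x \<in> roots sg br h \<union> {0} \<and>
     x \<in> graded_piece sg br h (\<beta> x) \<and> x \<in> root_space sg br h (\<beta> x))"
proof -
  obtain B where "finite_dimensional_vector_space sg B"
    using fin_dim_on_UNIV_basis[OF vector_space_axioms fin_dim] by blast
  then interpret g: finite_dimensional_vector_space sg B .
  obtain X where X: "X \<subseteq> {x. \<forall>y\<in>h. \<exists>c. br y x = sg c x}" "independent X"
      "{x. \<forall>y\<in>h. \<exists>c. br y x = sg c x} \<subseteq> span X"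
    by (rule maximal_independent_subset)
  have "finite X" using X(2) by (rule g.finiteI_independent)
  moreover have "span X = UNIV"
    using span_minimal[OF X(3) subspace_span] unfolding root_vectors_span by blast
  moreover have "\<forall>x\<in>X. \<exists>\<beta>. \<beta> \<in> roots sg br h \<union> {0} \<and>
     x \<in> graded_piece sg br h \<beta> \<and> x \<in> root_space sg br h \<beta>"
  proof
    fix x assume x: "x \<in> X"
    then have "x \<noteq> 0" using X(2) dependent_zero by blast
    with root_vector_weight[of x] x X(1)
    show "\<exists>\<beta>. \<beta> \<in> roots sg br h \<union> {0} \<and> x \<in> graded_piece sg br h \<beta> \<and> x \<in> root_space sg br h \<beta>"
      by blast
  qed
  ultimately show ?thesis by metis
qed

end

section \<open>From vanishing on a few weight spaces to vanishing on the module\<close>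

text \<open>Commuting \<open>z \<otimes> (s * r)\<close> past \<open>y \<otimes> q\<close> leaves a
  bracket whose second factor is again a multiple of \<open>s\<close>. The vectors killed by all
  such elements thus form a submodule, and it contains \<open>w\<close>.\<close>

lemma annihilated_vectors_all:
  assumes w: "w \<noteq> 0" "\<And>z r. act z (s * r) w = 0"
  shows "s \<in> annihilator"
proof -
  let ?A = "{v. \<forall>z r. act z (s * r) v = 0}"
  have A: "V.subspace ?A"
    by (rule V.subspaceI) (simp_all add: act_simps act_0)
  have "\<phi> a v \<in> ?A" if a: "a \<in> current" and v: "v \<in> ?A" for a v
  proof -
    have pure: "act y q v \<in> ?A" for y q
    proof (intro CollectI allI)
      fix z r
      show "act z (s * r) (act y q v) = 0"
        using act_bracket[of z y "s * r" q v] v by (simp add: act_0 mult.assoc)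
    qed
    \<comment> \<open>Stability extends from pure tensors by linearity. Membership in
      \<open>current\<close> is carried along because the action is assumed additive only
      there.\<close>
    have "vt.subspace {a \<in> current. \<phi> a v \<in> ?A}"
    proof (rule vt.subspaceI)
      show "0 \<in> {a \<in> current. \<phi> a v \<in> ?A}"
        using tens_in_current[of 0 0] pure[of 0 0] unfolding tens_0 by blast
      show "a + b \<in> {a \<in> current. \<phi> a v \<in> ?A}"
        if "a \<in> {a \<in> current. \<phi> a v \<in> ?A}" "b \<in> {a \<in> current. \<phi> a v \<in> ?A}" for a b
        using that vt.subspace_add[OF subspace_current, of a b]
          V.subspace_add[OF A, of "\<phi> a v" "\<phi> b v"] action_add[of a b v]
        by (metis (no_types, lifting) mem_Collect_eq)
      show "tensor_scale c a \<in> {a \<in> current. \<phi> a v \<in> ?A}"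
        if "a \<in> {a \<in> current. \<phi> a v \<in> ?A}" for c a
        using that vt.subspace_scale[OF subspace_current, of a c]
          V.subspace_scale[OF A, of "\<phi> a v" c] action_scale[of a c v]
        by (metis (no_types, lifting) mem_Collect_eq)
    qed
    moreover have "{x \<otimes> r | x r. x \<in> UNIV \<and> r \<in> UNIV} \<subseteq> {a \<in> current. \<phi> a v \<in> ?A}"
      using pure tens_in_current by blast
    ultimately have "vt.span {x \<otimes> r | x r. x \<in> UNIV \<and> r \<in> UNIV} \<subseteq> {a \<in> current. \<phi> a v \<in> ?A}"
      by (rule vt.span_minimal[rotated])
    with a show ?thesis unfolding tensor_sub_def by blast
  qed
  then have "?A = {0} \<or> ?A = UNIV" by (rule submodule_trivial[OF A])
  with w have "?A = UNIV" by blast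
  then have "act z (s * 1) v = 0" for z v by blast
  then show ?thesis by (simp add: annihilator_def)
qed

text \<open>Common to both claims of the theorem: it tests \<open>s\<close> only on a spanning set
  of root vectors, at the weight \<open>\<kappa>\<close> and its shifts by their weights.\<close>

lemma annihilator_if_kills_weight_spaces:
  assumes X: "span X = UNIV" "\<And>x. x \<in> X \<Longrightarrow> x \<in> root_space sg br h (\<beta> x)"
    and s0: "\<And>x w. x \<in> X \<Longrightarrow> w \<in> W \<kappa> \<Longrightarrow> act x s w = 0"
    and s1: "\<And>x y w. x \<in> X \<Longrightarrow> y \<in> X \<Longrightarrow> w \<in> W (\<kappa> + \<beta> y) \<Longrightarrow> act x s w = 0"
    and nz: "W \<kappa> \<noteq> {0}"
  shows "s \<in> annihilator"
proof -
  have spanX: "P x" if "\<And>x. x \<in> X \<Longrightarrow> P x" "P 0" "\<And>x y. P x \<Longrightarrow> P y \<Longrightarrow> P (x + y)"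
    "\<And>c x. P x \<Longrightarrow> P (sg c x)" for P and x :: 'g
  proof -
    have "subspace {x. P x}" using that(2-4) by (auto intro: subspaceI)
    then have "span X \<subseteq> {x. P x}" using that(1) by (intro span_minimal) auto
    then show ?thesis using X(1) by blast
  qed
  have kill0: "act x s w = 0" if "w \<in> W \<kappa>" for x w
    by (rule spanX[of _ x]) (use s0 that in \<open>simp_all add: act_simps act_0\<close>)
  have kill1: "act x s w = 0" if "y \<in> X" "w \<in> W (\<kappa> + \<beta> y)" for x y w
    by (rule spanX[of _ x]) (use s1 that in \<open>simp_all add: act_simps act_0\<close>)
  \<comment> \<open>For \<open>y \<in> X\<close> the vector \<open>act y r w\<close> has weight
    \<open>\<kappa> + \<beta> y\<close>, where \<open>kill1\<close> applies.\<close>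
  have kill2: "act x s (act y r w) = 0" if "w \<in> W \<kappa>" for x y r w
    by (rule spanX[of _ y])
      (use kill1 act_root_space[OF X(2) that] in \<open>simp_all add: act_simps act_0\<close>)
  \<comment> \<open>On brackets, \<open>br x y \<otimes> (s * r)\<close> is the bracket of
    \<open>x \<otimes> s\<close> and \<open>y \<otimes> r\<close>; \<open>kill2\<close> and
    \<open>kill0\<close> remove its two terms.\<close>
  have kill3: "act z (s * r) w = 0" if "w \<in> W \<kappa>" for z r w
  proof -
    have "subspace {z. act z (s * r) w = 0}"
      by (rule subspaceI) (simp_all add: act_simps act_0)
    moreover have "{br x y | x y. True} \<subseteq> {z. act z (s * r) w = 0}"
      using kill0[OF that] kill2[OF that] by (auto simp: act_bracket act_0)
    ultimately have "span {br x y | x y. True} \<subseteq> {z. act z (s * r) w = 0}"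
      by (rule span_minimal[rotated])
    then show ?thesis unfolding span_brackets by blast
  qed
  obtain w where "w \<in> W \<kappa>" "w \<noteq> 0"
    using nz V.subspace_0[OF subspace_weight_space, of \<kappa>] by blast
  then show ?thesis using kill3 by (intro annihilated_vectors_all[of w])
qed

lemma annihilator_eq_J_weight_roots:
  assumes "\<kappa> \<in> weights sg h ss sv \<phi>"
  shows "annihilator = J_weight_roots sg br h ss sv \<phi> \<kappa>"
proof
  show "annihilator \<subseteq> J_weight_roots sg br h ss sv \<phi> \<kappa>"
    by (auto simp: annihilator_def J_weight_roots_def J_weight_def J_vec_def J_root_def)
  show "J_weight_roots sg br h ss sv \<phi> \<kappa> \<subseteq> annihilator"
  proof
    fix s assume s: "s \<in> J_weight_roots sg br h ss sv \<phi> \<kappa>"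
    have kill: "act x s w = 0" if "\<beta> \<in> roots sg br h \<union> {0}" "\<gamma> \<in> roots sg br h \<union> {0}"
      "w \<in> W (\<kappa> + \<beta>)" "x \<in> graded_piece sg br h \<gamma>" for \<beta> \<gamma> w x
    proof -
      have "s \<in> J_weight sg br h ss sv \<phi> (\<kappa> + \<beta>)"
        using s that(1) unfolding J_weight_roots_def by blast
      then have "s \<in> J_root sg br h ss \<phi> \<gamma> w"
        using that(2,3) unfolding J_weight_def J_vec_def by blast
      then show ?thesis using that(4) by (simp add: J_root_def)
    qed
    show "s \<in> annihilator"
    proof (cases "\<forall>x s v. act x s v = 0")
      case True
      then show ?thesis by (simp add: annihilator_def)
    next
      case False
      then have "\<And>x. (\<And>v. act x 1 v = 0) \<Longrightarrow> x = 0" using faithful_or_trivial by blast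
      from finite_homogeneous_spanning_set[OF this] obtain X \<beta>
        where X: "span X = UNIV" "\<And>x. x \<in> X \<Longrightarrow> \<beta> x \<in> roots sg br h \<union> {0} \<and>
          x \<in> graded_piece sg br h (\<beta> x) \<and> x \<in> root_space sg br h (\<beta> x)" by metis
      show ?thesis
      proof (rule annihilator_if_kills_weight_spaces[OF X(1)])
        show "x \<in> root_space sg br h (\<beta> x)" if "x \<in> X" for x using X(2)[OF that] by blast
        \<comment> \<open>The weight \<open>\<kappa>\<close> itself is its shift by 0.\<close>
        show "act x s w = 0" if "x \<in> X" "w \<in> W \<kappa>" for x w
          using kill[of 0 "\<beta> x" w x] X(2)[OF that(1)] that(2) by simp
        show "act x s w = 0" if "x \<in> X" "y \<in> X" "w \<in> W (\<kappa> + \<beta> y)" for x y w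
          using kill[of "\<beta> y" "\<beta> x" w x] X(2)[OF that(1)] X(2)[OF that(2)] that(3) by blast
        show "W \<kappa> \<noteq> {0}" using assms by (simp add: weights_def)
      qed
    qed
  qed
qed

text \<open>The maps sending s to \<open>act x s w\<close>, with \<open>x \<in> X\<close> and
  \<open>w\<close> in a finite spanning set of \<open>W \<mu>\<close>, take values in the
  finite-dimensional space \<open>W (\<mu> + \<beta> x)\<close>. Finitely many of them have their
  common kernel inside \<open>annihilator\<close>.\<close>

lemma fin_dim_quotient_annihilator:
  assumes "\<kappa> \<in> weights sg h ss sv \<phi>"
  shows "fin_dim_quotient_algebra ss annihilator"
proof -
  have "\<exists>B. finite B \<and> (\<forall>s. \<exists>b\<in>S.span B. s - b \<in> annihilator)"
  proof (cases "\<forall>x s v. act x s v = 0")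
    case True
    then show ?thesis
      using S.span_zero by (intro exI[of _ "{}"]) (auto simp: annihilator_def)
  next
    case False
    then have "\<And>x. (\<And>v. act x 1 v = 0) \<Longrightarrow> x = 0" using faithful_or_trivial by blast
    from finite_homogeneous_spanning_set[OF this] obtain X \<beta>
      where X: "finite X" "span X = UNIV" "\<And>x. x \<in> X \<Longrightarrow> \<beta> x \<in> roots sg br h \<union> {0} \<and>
        x \<in> graded_piece sg br h (\<beta> x) \<and> x \<in> root_space sg br h (\<beta> x)" by metis
    have \<kappa>: "\<kappa> \<in> hdual" "W \<kappa> \<noteq> {0}" using assms by (auto simp: weights_def)
    have \<beta>: "\<beta> x \<in> hdual" if "x \<in> X" for x
      using X(3)[OF that] hdual_0 by (auto simp: roots_def)
    \<comment> \<open>Exactly the weights tested by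
      \<open>annihilator_if_kills_weight_spaces\<close>.\<close>
    define M where "M = insert \<kappa> ((\<lambda>y. \<kappa> + \<beta> y) ` X)"
    have M: "finite M" "M \<subseteq> hdual"
      using X(1) \<kappa>(1) \<beta> by (auto simp: M_def intro: hdual_add)
    have fd: "\<exists>C. finite C \<and> V.span C = W \<mu>" if "\<mu> \<in> hdual" for \<mu>
      using weight_module that by (auto simp: weight_module_def fin_dim_on_def)
    then obtain C where C: "\<And>\<mu>. \<mu> \<in> hdual \<Longrightarrow> finite (C \<mu>)" "\<And>\<mu>. \<mu> \<in> hdual \<Longrightarrow> V.span (C \<mu>) = W \<mu>"
      by metis
    define I where "I = X \<times> (SIGMA \<mu>:M. C \<mu>)"
    define f where "f = (\<lambda>(x, \<mu> :: 'g \<Rightarrow> 'k, w) s. act x s w)"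
    interpret pair: vector_space_pair ss sv
      using S.vector_space_axioms V.vector_space_axioms by (simp add: vector_space_pair_def)
    have "\<exists>B. finite B \<and> (\<forall>s. \<exists>b\<in>S.span B. \<forall>i\<in>I. f i (s - b) = 0)"
    proof (rule pair.finite_codim_common_kernel)
      show "finite I" using X(1) M C(1) by (auto simp: I_def)
      show "Vector_Spaces.linear ss sv (f i)" if "i \<in> I" for i
        by (cases i) (auto simp: f_def act_simps
            intro!: linear_mapI[OF S.vector_space_axioms V.vector_space_axioms])
      show "\<exists>D. finite D \<and> range (f i) \<subseteq> V.span D" if iI: "i \<in> I" for i
      proof -
        obtain x p where ip: "i = (x, p)" "x \<in> X" "p \<in> Sigma M C"
          using iI unfolding I_def by blast
        from ip(3) obtain \<mu> w where "p = (\<mu>, w)" "\<mu> \<in> M" "w \<in> C \<mu>" by blast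
        with ip have i: "i = (x, \<mu>, w)" "x \<in> X" "\<mu> \<in> M" "w \<in> C \<mu>" by simp_all
        then have \<mu>: "\<mu> \<in> hdual" using M(2) by blast
        then have "w \<in> W \<mu>" using C(2)[OF \<mu>] V.span_base[OF i(4)] by simp
        then have "act x s w \<in> W (\<mu> + \<beta> x)" for s
          using act_root_space X(3)[OF i(2)] by blast
        then have "range (f i) \<subseteq> V.span (C (\<mu> + \<beta> x))"
          using C(2)[OF hdual_add[OF \<mu> \<beta>[OF i(2)]]] by (auto simp: f_def i(1))
        then show ?thesis using C(1)[OF hdual_add[OF \<mu> \<beta>[OF i(2)]]] by blast
      qed
    qed
    moreover have "t \<in> annihilator" if t: "\<And>i. i \<in> I \<Longrightarrow> f i t = 0" for t
    proof -
      have kill: "act x t w = 0" if "x \<in> X" "\<mu> \<in> M" "w \<in> W \<mu>" for x \<mu> w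
      proof -
        have "V.subspace {w. act x t w = 0}"
          by (rule V.subspaceI) (simp_all add: act_simps act_0)
        moreover have "C \<mu> \<subseteq> {w. act x t w = 0}"
          using t[of "(x, \<mu>, _)"] that(1,2) by (auto simp: I_def f_def)
        ultimately have "V.span (C \<mu>) \<subseteq> {w. act x t w = 0}" by (rule V.span_minimal[rotated])
        then show ?thesis using C(2)[of \<mu>] M(2) that(2,3) by blast
      qed
      show ?thesis
      proof (rule annihilator_if_kills_weight_spaces[OF X(2)])
        show "x \<in> root_space sg br h (\<beta> x)" if "x \<in> X" for x using X(3)[OF that] by blast
        show "act x t w = 0" if "x \<in> X" "w \<in> W \<kappa>" for x w
          using kill[OF that(1) _ that(2)] by (simp add: M_def)
        show "act x t w = 0" if "x \<in> X" "y \<in> X" "w \<in> W (\<kappa> + \<beta> y)" for x y w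
          using kill[OF that(1) _ that(3)] that(2) by (simp add: M_def)
      qed (rule \<kappa>(2))
    qed
    ultimately show ?thesis by meson
  qed
  then obtain B where B: "finite B" "\<And>s. \<exists>b\<in>S.span B. s - b \<in> annihilator" by blast
  have sub: "S.subspace annihilator"
    by (rule ring_ideal_subspace[OF kernel_ideal_eq_annihilator(1)])
  have "residue_class annihilator s \<in> residue_class annihilator ` S.span B" for s
  proof -
    obtain b where b: "b \<in> S.span B" "s - b \<in> annihilator" using B(2) by blast
    have "t - s \<in> annihilator \<longleftrightarrow> t - b \<in> annihilator" for t
      using S.subspace_add[OF sub, of "t - s" "s - b"] S.subspace_diff[OF sub, of "t - b" "s - b"] b(2)
      by auto
    then have "residue_class annihilator s = residue_class annihilator b"
      by (simp add: residue_class_def)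
    then show ?thesis using b(1) by blast
  qed
  then have "range (residue_class annihilator) = residue_class annihilator ` S.span B" by blast
  then show ?thesis
    using B(1) kernel_ideal_eq_annihilator(1) by (auto simp: fin_dim_quotient_algebra_def)
qed

end

theorem proposition4p3:
  fixes sg :: "'k::{alg_closed_field,field_char_0} \<Rightarrow> 'g::ab_group_add \<Rightarrow> 'g"
    and br :: "'g \<Rightarrow> 'g \<Rightarrow> 'g"
    and h :: "'g set"
    and ss :: "'k \<Rightarrow> 's::{comm_ring,comm_monoid_mult} \<Rightarrow> 's"
    and sv :: "'k \<Rightarrow> 'v::ab_group_add \<Rightarrow> 'v"
    and \<phi> :: "('k, 'g, 's) tensor \<Rightarrow> 'v \<Rightarrow> 'v"
    and lam :: "'g \<Rightarrow> 'k"
  assumes "simple_lie_algebra sg br"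
    and "fin_dim_on sg UNIV"
    and "cartan_subalgebra sg br h"
    and "comm_algebra ss"
    and "finite_type ss"
    and "simple_current_module sg br ss sv \<phi>"
    and "weight_module sg h ss sv \<phi>"
    and "lam \<in> weights sg h ss sv \<phi>"
  shows "kernel_ideal sg ss \<phi> = J_weight_roots sg br h ss sv \<phi> lam \<and>
         fin_dim_quotient_algebra ss (kernel_ideal sg ss \<phi>)"
proof -
  interpret simple_lie_algebra sg br by fact
  interpret S: comm_algebra ss by fact
  interpret V: simple_current_module sg br ss sv \<phi> by fact
  interpret simple_weight_module sg br ss sv \<phi> h
    by unfold_locales (fact assms)+
  show ?thesis
    unfolding kernel_ideal_eq_annihilator(2)
    using annihilator_eq_J_weight_roots[OF assms(8)] fin_dim_quotient_annihilator[OF assms(8)]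
    by blast
qed

end
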